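(* Let $G$ be a finitely generated group acting by isometries on a product of quasi-trees $X=X_1\times\cdots\times X_N$ (with $N\geq 1$), where $X$ is endowed with the metric $d_X(x,y)=\sum_{i=1}^N d_i(x_i,y_i)$, $d_i$ being the metric of $X_i$. Let $o\in X$. Then $G$ admits a uniformly Lipschitz affine action $\sigma$ on $\ell^1$ such that, for some constant $C>0$, $$\|\sigma(s)0\|_1\geq \frac{1}{C}\,d_X(s\cdot o,o)-C,\qquad \forall s\in G.$$
   Context: A map $g:X\to Y$ between metric spaces is a quasi-isometric embedding if there is $A\geq 1$ with $\frac1A d_X(x_1,x_2)-A\leq d_Y(g(x_1),g(x_2))\leq A d_X(x_1,x_2)+A$ for all $x_1,x_2\in X$. It is a quasi-isometry if moreover there is $C>0$ such that every ball of radius $C$ in $Y$ intersects $g(X)$. A metric space is a quasi-tree if it is quasi-isometric to a simplicial tree (a connected graph without cycles, with its edge-path distance). An affine action of $G$ on a Banach space $E$ is an action of the form $\sigma(s)v=\pi(s)v+b(s)$, where $\pi:G\to\operatorname{GL}(E)$ is a homomorphism into the group of bounded invertible operators on $E$ and $b:G\to E$ satisfies $b(st)=\pi(s)b(t)+b(s)$ for all $s,t\in G$. It is uniformly Lipschitz if $\sup_{s\in G}\|\pi(s)\|<\infty$. $\ell^1$ is the Banach space of absolutely summable sequences with norm $\|\cdot\|_1$. *)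

theory Defs
  imports
    "HOL-Analysis.Analysis"
    "HOL-Algebra.Group_Action"
    "HOL-Algebra.Generated_Groups"
begin

section \<open>Quasi-isometries\<close>

definition quasi_isometric_embedding :: "'a metric \<Rightarrow> 'b metric \<Rightarrow> ('a \<Rightarrow> 'b) \<Rightarrow> bool" where
  "quasi_isometric_embedding X Y g \<longleftrightarrow>
     g ` mspace X \<subseteq> mspace Y \<and>
     (\<exists>A::real. A \<ge> 1 \<and>
       (\<forall>x1\<in>mspace X. \<forall>x2\<in>mspace X.
          1 / A * mdist X x1 x2 - A \<le> mdist Y (g x1) (g x2) \<and>
          mdist Y (g x1) (g x2) \<le> A * mdist X x1 x2 + A))"

definition quasi_isometry :: "'a metric \<Rightarrow> 'b metric \<Rightarrow> ('a \<Rightarrow> 'b) \<Rightarrow> bool" where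
  "quasi_isometry X Y g \<longleftrightarrow>
     quasi_isometric_embedding X Y g \<and>
     (\<exists>C>0. \<forall>y\<in>mspace Y. mball_of Y y C \<inter> g ` mspace X \<noteq> {})"


section \<open>Simplicial trees\<close>

text \<open>A graph is given by its vertex set \<open>V\<close> and its set \<open>E\<close> of edges, which are two-element
  subsets of \<open>V\<close>. Loops and multiple edges are cycles, so simple graphs suffice for trees.\<close>

definition simple_graph :: "'v set \<Rightarrow> 'v set set \<Rightarrow> bool" where
  "simple_graph V E \<longleftrightarrow> (\<forall>e\<in>E. \<exists>u\<in>V. \<exists>v\<in>V. u \<noteq> v \<and> e = {u, v})"

definition walk :: "'v set \<Rightarrow> 'v set set \<Rightarrow> 'v list \<Rightarrow> bool" where
  "walk V E p \<longleftrightarrow> p \<noteq> [] \<and> set p \<subseteq> V \<and> successively (\<lambda>u v. {u, v} \<in> E) p"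

definition connected_graph :: "'v set \<Rightarrow> 'v set set \<Rightarrow> bool" where
  "connected_graph V E \<longleftrightarrow>
     simple_graph V E \<and> V \<noteq> {} \<and>
     (\<forall>u\<in>V. \<forall>v\<in>V. \<exists>p. walk V E p \<and> hd p = u \<and> last p = v)"

definition graph_cycle :: "'v set \<Rightarrow> 'v set set \<Rightarrow> 'v list \<Rightarrow> bool" where
  "graph_cycle V E p \<longleftrightarrow>
     walk V E p \<and> distinct p \<and> length p \<ge> 3 \<and> {last p, hd p} \<in> E"

definition simplicial_tree :: "'v set \<Rightarrow> 'v set set \<Rightarrow> bool" where
  "simplicial_tree V E \<longleftrightarrow> connected_graph V E \<and> \<not> (\<exists>p. graph_cycle V E p)"

text \<open>A walk with \<open>n\<close> edges is a list of \<open>n + 1\<close> vertices.\<close>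

definition edge_path_dist :: "'v set \<Rightarrow> 'v set set \<Rightarrow> 'v \<Rightarrow> 'v \<Rightarrow> nat" where
  "edge_path_dist V E u v =
     (LEAST n. \<exists>p. walk V E p \<and> hd p = u \<and> last p = v \<and> length p = Suc n)"

definition graph_metric :: "'v set \<Rightarrow> 'v set set \<Rightarrow> 'v metric" where
  "graph_metric V E = metric (V, \<lambda>u v. real (edge_path_dist V E u v))"

lemma edge_path_dist_walk:
  assumes "connected_graph V E" "u \<in> V" "v \<in> V"
  obtains p where "walk V E p" "hd p = u" "last p = v" "length p = Suc (edge_path_dist V E u v)"
proof -
  obtain p where p: "walk V E p" "hd p = u" "last p = v"
    using assms unfolding connected_graph_def by blast
  then have "length p = Suc (length p - 1)"
    by (simp add: walk_def)
  with p have "\<exists>n p. walk V E p \<and> hd p = u \<and> last p = v \<and> length p = Suc n"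
    by blast
  from LeastI_ex[OF this] show ?thesis
    unfolding edge_path_dist_def[symmetric] using that by blast
qed

lemma edge_path_dist_le:
  assumes "walk V E p" "hd p = u" "last p = v" "length p = Suc n"
  shows "edge_path_dist V E u v \<le> n"
  unfolding edge_path_dist_def using assms by (intro Least_le) blast

lemma walk_rev: "walk V E p \<Longrightarrow> walk V E (rev p)"
  by (auto simp: walk_def insert_commute)

lemma walk_append_tl:
  assumes "walk V E p" "walk V E q" "last p = hd q"
  shows "walk V E (p @ tl q)"
proof (cases "tl q = []")
  case True
  then show ?thesis using assms by simp
next
  case False
  then show ?thesis
    using assms by (cases q) (auto simp: walk_def successively_append_iff successively_Cons)
qed

lemma Metric_space_graph:
  assumes "connected_graph V E"
  shows "Metric_space V (\<lambda>u v. real (edge_path_dist V E u v))"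
proof
  show "0 \<le> real (edge_path_dist V E u v)" for u v by simp
  show "real (edge_path_dist V E u v) = real (edge_path_dist V E v u)" for u v
  proof -
    have "(walk V E p \<and> hd p = u \<and> last p = v \<and> length p = Suc n) \<longleftrightarrow>
          (walk V E (rev p) \<and> hd (rev p) = v \<and> last (rev p) = u \<and> length (rev p) = Suc n)" for p n u v
      using walk_rev[of V E p] walk_rev[of V E "rev p"] by (auto simp: hd_rev last_rev walk_def)
    then have "(\<exists>p. walk V E p \<and> hd p = u \<and> last p = v \<and> length p = Suc n) \<longleftrightarrow>
          (\<exists>p. walk V E p \<and> hd p = v \<and> last p = u \<and> length p = Suc n)" for n
      by (metis rev_rev_ident)
    then show ?thesis by (simp add: edge_path_dist_def)
  qed
  show "real (edge_path_dist V E u v) = 0 \<longleftrightarrow> u = v" if uv: "u \<in> V" "v \<in> V" for u v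
  proof
    assume "real (edge_path_dist V E u v) = 0"
    then obtain p where "walk V E p" "hd p = u" "last p = v" "length p = Suc 0"
      using edge_path_dist_walk[OF assms uv] by (metis of_nat_eq_0_iff)
    then show "u = v" by (cases p) auto
  next
    assume "u = v"
    then have "edge_path_dist V E u v \<le> 0"
      using uv by (intro edge_path_dist_le[of V E "[u]"]) (auto simp: walk_def)
    then show "real (edge_path_dist V E u v) = 0" by simp
  qed
  show "real (edge_path_dist V E u w) \<le> real (edge_path_dist V E u v) + real (edge_path_dist V E v w)"
    if uvw: "u \<in> V" "v \<in> V" "w \<in> V" for u v w
  proof -
    obtain p where p: "walk V E p" "hd p = u" "last p = v" "length p = Suc (edge_path_dist V E u v)"
      using edge_path_dist_walk[OF assms] uvw by metis
    obtain q where q: "walk V E q" "hd q = v" "last q = w" "length q = Suc (edge_path_dist V E v w)"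
      using edge_path_dist_walk[OF assms] uvw by metis
    have "p \<noteq> []" "q \<noteq> []" using p q by (auto simp: walk_def)
    have "last (p @ tl q) = w"
      using p q \<open>p \<noteq> []\<close> \<open>q \<noteq> []\<close> by (cases q) (auto split: if_splits)
    then have "edge_path_dist V E u w \<le> edge_path_dist V E u v + edge_path_dist V E v w"
      using p q \<open>p \<noteq> []\<close>
      by (intro edge_path_dist_le[of V E "p @ tl q"]) (auto intro!: walk_append_tl)
    then show ?thesis by linarith
  qed
qed

lemma graph_metric_simps:
  assumes "connected_graph V E"
  shows "mspace (graph_metric V E) = V"
    and "mdist (graph_metric V E) u v = real (edge_path_dist V E u v)"
  using Metric_space.mspace_metric[OF Metric_space_graph[OF assms]]
    Metric_space.mdist_metric[OF Metric_space_graph[OF assms]]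
  by (simp_all add: graph_metric_def)

text \<open>The vertex type \<open>'v\<close> of the tree is a parameter, since one cannot quantify over types inside
  a definition. The vertex set with the edge-path distance is quasi-isometric to the geometric
  realization of the tree.\<close>

definition quasi_tree :: "'v itself \<Rightarrow> 'a metric \<Rightarrow> bool" where
  "quasi_tree (_ :: 'v itself) M \<longleftrightarrow>
     (\<exists>(V :: 'v set) E g. simplicial_tree V E \<and> quasi_isometry M (graph_metric V E) g)"


section \<open>Finite products with the sum metric\<close>

definition sum_dist :: "nat \<Rightarrow> (nat \<Rightarrow> 'a metric) \<Rightarrow> (nat \<Rightarrow> 'a) \<Rightarrow> (nat \<Rightarrow> 'a) \<Rightarrow> real" where
  "sum_dist N X x y = (\<Sum>i=1..N. mdist (X i) (x i) (y i))"

definition sum_product :: "nat \<Rightarrow> (nat \<Rightarrow> 'a metric) \<Rightarrow> (nat \<Rightarrow> 'a) metric" where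
  "sum_product N X = metric (\<Pi>\<^sub>E i\<in>{1..N}. mspace (X i), sum_dist N X)"

lemma Metric_space_sum_product: "Metric_space (\<Pi>\<^sub>E i\<in>{1..N}. mspace (X i)) (sum_dist N X)"
proof
  fix x y z
  show "0 \<le> sum_dist N X x y" by (simp add: sum_dist_def sum_nonneg)
  show "sum_dist N X x y = sum_dist N X y x" by (simp add: sum_dist_def mdist_commute)
  assume x: "x \<in> (\<Pi>\<^sub>E i\<in>{1..N}. mspace (X i))" and y: "y \<in> (\<Pi>\<^sub>E i\<in>{1..N}. mspace (X i))"
  have "sum_dist N X x y = 0 \<longleftrightarrow> (\<forall>i\<in>{1..N}. mdist (X i) (x i) (y i) = 0)"
    unfolding sum_dist_def by (rule sum_nonneg_eq_0_iff) auto
  also have "\<dots> \<longleftrightarrow> (\<forall>i\<in>{1..N}. x i = y i)"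
    using PiE_mem[OF x] PiE_mem[OF y] by (intro ball_cong refl mdist_zero)
  also have "\<dots> \<longleftrightarrow> x = y"
    using PiE_ext[OF x y] by blast
  finally show "sum_dist N X x y = 0 \<longleftrightarrow> x = y" .
  assume z: "z \<in> (\<Pi>\<^sub>E i\<in>{1..N}. mspace (X i))"
  show "sum_dist N X x z \<le> sum_dist N X x y + sum_dist N X y z"
    unfolding sum_dist_def sum.distrib[symmetric]
    using PiE_mem[OF x] PiE_mem[OF y] PiE_mem[OF z] by (intro sum_mono mdist_triangle)
qed

lemma sum_product_simps [simp]:
  shows "mspace (sum_product N X) = (\<Pi>\<^sub>E i\<in>{1..N}. mspace (X i))"
    and "mdist (sum_product N X) = sum_dist N X"
  using Metric_space.mspace_metric[OF Metric_space_sum_product]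
    Metric_space.mdist_metric[OF Metric_space_sum_product]
  by (simp_all add: sum_product_def)


section \<open>The Banach space of absolutely summable sequences\<close>

typedef l1 = "{x :: nat \<Rightarrow> real. summable (\<lambda>n. \<bar>x n\<bar>)}"
  morphisms l1_nth Abs_l1
  by (rule exI[of _ "\<lambda>_. 0"]) simp

setup_lifting type_definition_l1

lemma l1_eqI: "(\<And>n. l1_nth x n = l1_nth y n) \<Longrightarrow> x = y"
  by (metis ext l1_nth_inject)

lemma summable_l1_nth: "summable (\<lambda>n. \<bar>l1_nth x n\<bar>)"
  using l1_nth[of x] by simp

instantiation l1 :: real_vector
begin

lift_definition zero_l1 :: l1 is "\<lambda>_. 0" by simp

lift_definition plus_l1 :: "l1 \<Rightarrow> l1 \<Rightarrow> l1" is "\<lambda>x y n. x n + y n"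
proof -
  fix x y :: "nat \<Rightarrow> real"
  assume "summable (\<lambda>n. \<bar>x n\<bar>)" "summable (\<lambda>n. \<bar>y n\<bar>)"
  then have "summable (\<lambda>n. \<bar>x n\<bar> + \<bar>y n\<bar>)" by (rule summable_add)
  then show "summable (\<lambda>n. \<bar>x n + y n\<bar>)"
    by (rule summable_comparison_test'[where N = 0]) auto
qed

lift_definition uminus_l1 :: "l1 \<Rightarrow> l1" is "\<lambda>x n. - x n" by simp

lift_definition minus_l1 :: "l1 \<Rightarrow> l1 \<Rightarrow> l1" is "\<lambda>x y n. x n - y n"
proof -
  fix x y :: "nat \<Rightarrow> real"
  assume "summable (\<lambda>n. \<bar>x n\<bar>)" "summable (\<lambda>n. \<bar>y n\<bar>)"
  then have "summable (\<lambda>n. \<bar>x n\<bar> + \<bar>y n\<bar>)" by (rule summable_add)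
  then show "summable (\<lambda>n. \<bar>x n - y n\<bar>)"
    by (rule summable_comparison_test'[where N = 0]) auto
qed

lift_definition scaleR_l1 :: "real \<Rightarrow> l1 \<Rightarrow> l1" is "\<lambda>c x n. c * x n"
  by (simp add: abs_mult summable_mult)

instance
  by standard (transfer; simp add: algebra_simps fun_eq_iff)+

end

instantiation l1 :: real_normed_vector
begin

definition norm_l1 :: "l1 \<Rightarrow> real" where
  "norm_l1 x = (\<Sum>n. \<bar>l1_nth x n\<bar>)"

definition sgn_l1 :: "l1 \<Rightarrow> l1" where
  "sgn_l1 x = inverse (norm x) *\<^sub>R x"

definition dist_l1 :: "l1 \<Rightarrow> l1 \<Rightarrow> real" where
  "dist_l1 x y = norm (x - y)"

definition uniformity_l1 :: "(l1 \<times> l1) filter" where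
  "uniformity_l1 = (INF e\<in>{0<..}. principal {(x, y). dist x y < e})"

definition open_l1 :: "l1 set \<Rightarrow> bool" where
  "open_l1 U \<longleftrightarrow> (\<forall>x\<in>U. \<forall>\<^sub>F (x', y) in uniformity. x' = x \<longrightarrow> y \<in> U)"

instance
proof
  fix x y :: l1 and c :: real and U :: "l1 set"
  show "dist x y = norm (x - y)" by (rule dist_l1_def)
  show "sgn x = inverse (norm x) *\<^sub>R x" by (rule sgn_l1_def)
  show "uniformity = (INF e\<in>{0<..}. principal {(x, y :: l1). dist x y < e})"
    by (rule uniformity_l1_def)
  show "open U \<longleftrightarrow> (\<forall>x\<in>U. \<forall>\<^sub>F (x', y) in uniformity. x' = x \<longrightarrow> y \<in> U)"
    by (rule open_l1_def)
  have "norm x = 0 \<longleftrightarrow> (\<forall>n. \<bar>l1_nth x n\<bar> = 0)"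
    unfolding norm_l1_def by (rule suminf_eq_zero_iff[OF summable_l1_nth]) simp
  then show "norm x = 0 \<longleftrightarrow> x = 0"
    by (auto simp: zero_l1.rep_eq intro: l1_eqI)
  have "norm (x + y) \<le> (\<Sum>n. \<bar>l1_nth x n\<bar> + \<bar>l1_nth y n\<bar>)"
    unfolding norm_l1_def
    by (rule suminf_le[OF _ summable_l1_nth summable_add[OF summable_l1_nth summable_l1_nth]])
       (simp add: plus_l1.rep_eq)
  also have "\<dots> = norm x + norm y"
    unfolding norm_l1_def by (rule suminf_add[symmetric]) (rule summable_l1_nth)+
  finally show "norm (x + y) \<le> norm x + norm y" .
  show "norm (c *\<^sub>R x) = \<bar>c\<bar> * norm x"
    by (simp add: norm_l1_def scaleR_l1.rep_eq abs_mult suminf_mult summable_l1_nth)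
qed

end

lemma sum_le_norm_l1: "finite F \<Longrightarrow> (\<Sum>n\<in>F. \<bar>l1_nth x n\<bar>) \<le> norm x"
  unfolding norm_l1_def by (rule sum_le_suminf[OF summable_l1_nth]) auto

lemma abs_l1_nth_le_norm: "\<bar>l1_nth x n\<bar> \<le> norm x"
  using sum_le_norm_l1[of "{n}" x] by simp

instance l1 :: banach
proof
  fix X :: "nat \<Rightarrow> l1"
  assume X: "Cauchy X"
  have "Cauchy (\<lambda>k. l1_nth (X k) n)" for n
  proof (rule CauchyI)
    fix e :: real assume "e > 0"
    then obtain M where M: "\<forall>j\<ge>M. \<forall>k\<ge>M. norm (X j - X k) < e"
      using CauchyD[OF X] by blast
    have "norm (l1_nth (X j) n - l1_nth (X k) n) < e" if "j \<ge> M" "k \<ge> M" for j k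
      using abs_l1_nth_le_norm[of "X j - X k" n] M that
      by (fastforce simp: minus_l1.rep_eq)
    then show "\<exists>M. \<forall>j\<ge>M. \<forall>k\<ge>M. norm (l1_nth (X j) n - l1_nth (X k) n) < e" by blast
  qed
  then have "\<exists>l. (\<lambda>k. l1_nth (X k) n) \<longlonglongrightarrow> l" for n
    using Cauchy_convergent convergent_def by blast
  then obtain l where l: "(\<lambda>k. l1_nth (X k) n) \<longlonglongrightarrow> l n" for n
    by metis
  have tail: "\<exists>M. \<forall>k\<ge>M. \<forall>m. (\<Sum>n<m. \<bar>l n - l1_nth (X k) n\<bar>) \<le> e" if "e > 0" for e
  proof -
    obtain M where M: "\<forall>j\<ge>M. \<forall>k\<ge>M. norm (X j - X k) < e"
      using CauchyD[OF X] \<open>e > 0\<close> by blast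
    have "(\<Sum>n<m. \<bar>l n - l1_nth (X k) n\<bar>) \<le> e" if "k \<ge> M" for k m
    proof (rule LIMSEQ_le_const2)
      show "(\<lambda>j. \<Sum>n<m. \<bar>l1_nth (X j) n - l1_nth (X k) n\<bar>) \<longlonglongrightarrow> (\<Sum>n<m. \<bar>l n - l1_nth (X k) n\<bar>)"
        by (intro tendsto_intros l)
      have "(\<Sum>n<m. \<bar>l1_nth (X j) n - l1_nth (X k) n\<bar>) \<le> e" if "j \<ge> M" for j
        using sum_le_norm_l1[of "{..<m}" "X j - X k"] M \<open>k \<ge> M\<close> that
        by (fastforce simp: minus_l1.rep_eq)
      then show "\<exists>M. \<forall>j\<ge>M. (\<Sum>n<m. \<bar>l1_nth (X j) n - l1_nth (X k) n\<bar>) \<le> e" by blast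
    qed
    then show ?thesis by blast
  qed
  have diff: "summable (\<lambda>n. \<bar>l n - l1_nth (X k) n\<bar>)"
    if "\<forall>m. (\<Sum>n<m. \<bar>l n - l1_nth (X k) n\<bar>) \<le> e" for k e
    using that by (intro bounded_imp_summable[where B = e]) (auto simp: lessThan_Suc_atMost[symmetric] simp del: sum.lessThan_Suc)
  obtain K where "\<forall>m. (\<Sum>n<m. \<bar>l n - l1_nth (X K) n\<bar>) \<le> 1"
    using tail[of 1] by fastforce
  then have "summable (\<lambda>n. \<bar>l n - l1_nth (X K) n\<bar> + \<bar>l1_nth (X K) n\<bar>)"
    by (intro summable_add summable_l1_nth) (rule diff)
  then have "summable (\<lambda>n. \<bar>l n\<bar>)"
    by (rule summable_comparison_test'[where N = 0]) auto
  then have nth: "l1_nth (Abs_l1 l) = l"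
    by (simp add: Abs_l1_inverse)
  have "X \<longlonglongrightarrow> Abs_l1 l"
  proof (rule LIMSEQ_I)
    fix e :: real assume "e > 0"
    then obtain M where M: "\<forall>k\<ge>M. \<forall>m. (\<Sum>n<m. \<bar>l n - l1_nth (X k) n\<bar>) \<le> e / 2"
      using tail[of "e / 2"] by auto
    have "norm (X k - Abs_l1 l) < e" if "k \<ge> M" for k
    proof -
      have "norm (Abs_l1 l - X k) \<le> e / 2"
        unfolding norm_l1_def minus_l1.rep_eq nth
        using M that by (intro suminf_le_const diff[where e = "e / 2"]) auto
      then show ?thesis using \<open>e > 0\<close> by (simp add: norm_minus_commute)
    qed
    then show "\<exists>M. \<forall>k\<ge>M. norm (X k - Abs_l1 l) < e" by blast
  qed
  then show "convergent X" by (auto simp: convergent_def)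
qed


section \<open>Finitely generated groups and affine actions\<close>

definition finitely_generated :: "('g, 'm) monoid_scheme \<Rightarrow> bool" where
  "finitely_generated G \<longleftrightarrow> (\<exists>S. finite S \<and> S \<subseteq> carrier G \<and> generate G S = carrier G)"

definition isometric_action ::
    "('g, 'm) monoid_scheme \<Rightarrow> 'a metric \<Rightarrow> ('g \<Rightarrow> 'a \<Rightarrow> 'a) \<Rightarrow> bool" where
  "isometric_action G M \<phi> \<longleftrightarrow>
     group_action G (mspace M) \<phi> \<and>
     (\<forall>s\<in>carrier G. \<forall>x\<in>mspace M. \<forall>y\<in>mspace M. mdist M (\<phi> s x) (\<phi> s y) = mdist M x y)"

definition bounded_operators :: "('e::real_normed_vector \<Rightarrow>\<^sub>L 'e) monoid" where
  "bounded_operators = \<lparr>carrier = UNIV, mult = (o\<^sub>L), one = id_blinfun\<rparr>"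

definition GL :: "('e::real_normed_vector \<Rightarrow>\<^sub>L 'e) monoid" where
  "GL = units_of bounded_operators"

lemma group_GL: "group GL"
proof -
  have "Group.monoid bounded_operators"
    by (rule monoidI) (auto simp: bounded_operators_def intro: blinfun_eqI)
  then show ?thesis unfolding GL_def by (rule monoid.units_group)
qed

definition affine_action ::
    "('g, 'm) monoid_scheme \<Rightarrow> ('g \<Rightarrow> 'e \<Rightarrow>\<^sub>L 'e) \<Rightarrow> ('g \<Rightarrow> 'e) \<Rightarrow> ('g \<Rightarrow> 'e::banach \<Rightarrow> 'e) \<Rightarrow> bool" where
  "affine_action G \<pi> b \<sigma> \<longleftrightarrow>
     \<pi> \<in> hom G GL \<and>
     (\<forall>s\<in>carrier G. \<forall>t\<in>carrier G. b (s \<otimes>\<^bsub>G\<^esub> t) = blinfun_apply (\<pi> s) (b t) + b s) \<and>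
     (\<forall>s\<in>carrier G. \<forall>v. \<sigma> s v = blinfun_apply (\<pi> s) v + b s)"

definition uniformly_Lipschitz_affine_action ::
    "('g, 'm) monoid_scheme \<Rightarrow> ('g \<Rightarrow> 'e::banach \<Rightarrow> 'e) \<Rightarrow> bool" where
  "uniformly_Lipschitz_affine_action G \<sigma> \<longleftrightarrow>
     (\<exists>\<pi> b. affine_action G \<pi> b \<sigma> \<and> bdd_above ((\<lambda>s. norm (\<pi> s)) ` carrier G))"

end

theory Submission
  imports Defs
begin

text \<open>For a rooted tree \<open>T\<close>, the Lipschitz-free space of \<open>T\<close> is \<open>\<ell>\<^sup>1\<close> of the edges, and any isometric
  action on a space bilipschitz to \<open>T\<close> induces a uniformly bounded representation on it, with cocycle
  \<open>s \<mapsto> \<delta>(s q) - \<delta>(q)\<close>. A quasi-tree carries a tree structure on its own points for which, after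
  adding 1 to all nonzero distances, the two metrics are bilipschitz.

  For a product, one takes the sum of the free spaces of the factors, together with a copy of \<open>\<ell>\<^sup>1\<close>
  that absorbs bounded errors. An isometry of the product need not permute the factors. However, it
  maps rectangles to rectangles in every coordinate separately, and a quasi-tree contains no wide
  coarsely connected rectangle. Hence each coordinate of the image depends, up to a
  uniformly bounded error, on one coordinate of the argument only.\<close>

section \<open>Rooted trees\<close>

text \<open>\<open>l1\<close> has countably many basis vectors while the product may be uncountable.
  Only a countable set of points is therefore used: it contains the orbit of the base point
  \<open>q\<close>, which is countable because \<open>G\<close> is finitely generated, and it is
  closed under keeping a single coordinate and under passing to parents. On it the vectors
  \<delta>(y) - \<delta>(q) and the basis vectors of \<open>l1\<close> in use are finite
  combinations of each other, so translation determines the representation, and what remains is a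
  bound on the images of basis vectors that is uniform in \<open>s\<close>. For a tree edge this is
  a coarse Lipschitz estimate. The obstacle is a point \<open>y\<close> that differs from
  \<open>q\<close> in several coordinates: \<delta>(y) - \<delta>(q) minus its single-coordinate
  versions projects to zero in every factor, but its translate need not. Such a \<open>y\<close>
  gets a basis vector of its own, and its image is bounded because each coordinate of an isometry
  nearly depends on one coordinate only. The error there comes from the tree constants alone, hence
  does not depend on \<open>s\<close>.\<close>

lemma walk_subset: "walk V E p \<Longrightarrow> E \<subseteq> E' \<Longrightarrow> walk V E' p"
  by (auto simp: walk_def intro: successively_mono)

lemma rtrancl_imp_walk:
  assumes "(u, v) \<in> {(x, y). x \<in> V \<and> y \<in> V \<and> {x, y} \<in> E}\<^sup>*" "u \<in> V"
  shows "\<exists>p. walk V E p \<and> hd p = u \<and> last p = v"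
  using assms
proof (induction rule: rtrancl_induct)
  case base
  then show ?case by (intro exI[of _ "[u]"]) (auto simp: walk_def)
next
  case (step y z)
  then obtain p where "walk V E p" "hd p = u" "last p = y" by auto
  then show ?case using step by (intro exI[of _ "p @ [z]"]) (auto simp: walk_def successively_append_iff)
qed

text \<open>The segment between two occurrences of a vertex can be cut out without changing the
  ends.\<close>

lemma walk_imp_distinct_walk:
  assumes "walk V E p"
  shows "\<exists>q. walk V E q \<and> hd q = hd p \<and> last q = last p \<and> distinct q"
  using assms
proof (induction "length p" arbitrary: p rule: less_induct)
  case less
  show ?case
  proof (cases "distinct p")
    case True
    then show ?thesis using less by auto
  next
    case False
    then obtain xs ys zs y where p: "p = xs @ [y] @ ys @ [y] @ zs"
      using not_distinct_decomp by blast
    have "walk V E (xs @ [y] @ zs)"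
      using less.prems unfolding p by (auto simp: walk_def successively_append_iff successively_Cons)
    moreover have "hd (xs @ [y] @ zs) = hd p" "last (xs @ [y] @ zs) = last p"
      by (auto simp: p hd_append)
    ultimately show ?thesis using less.hyps[of "xs @ [y] @ zs"] by (auto simp: p)
  qed
qed

text \<open>A simple walk from \<open>u\<close> to \<open>v\<close> avoiding the edge has at least
  three vertices, and the edge closes it to a cycle.\<close>

lemma acyclic_edge_is_bridge:
  assumes "simplicial_tree V E" "{u, v} \<in> E" "u \<in> V" "u \<noteq> v"
  shows "(u, v) \<notin> {(x, y). x \<in> V \<and> y \<in> V \<and> {x, y} \<in> E - {{u, v}}}\<^sup>*"
proof
  assume "(u, v) \<in> {(x, y). x \<in> V \<and> y \<in> V \<and> {x, y} \<in> E - {{u, v}}}\<^sup>*"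
  from rtrancl_imp_walk[OF this \<open>u \<in> V\<close>] walk_imp_distinct_walk
  obtain p where p: "walk V (E - {{u, v}}) p" "hd p = u" "last p = v" "distinct p"
    by metis
  obtain q where q: "p = u # q" using p by (cases p) (auto simp: walk_def)
  then obtain w q' where q': "q = w # q'" using p \<open>u \<noteq> v\<close> by (cases q) auto
  have "q' \<noteq> []" using p unfolding q q' by (auto simp: walk_def)
  then have "length p \<ge> 3" unfolding q q' by (cases q') auto
  then have "graph_cycle V E p"
    using p assms walk_subset[of V "E - {{u, v}}" p E]
    by (auto simp: graph_cycle_def insert_commute)
  then show False using assms by (auto simp: simplicial_tree_def)
qed

locale rooted_tree =
  fixes V :: "'v set" and E and root
  assumes tree: "simplicial_tree V E" and root: "root \<in> V"
begin

abbreviation "ed \<equiv> edge_path_dist V E"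
definition "dep = ed root"
definition "par v = (SOME u. u \<in> V \<and> {u, v} \<in> E \<and> dep v = Suc (dep u))"
text \<open>The depth \<open>m\<close> is counted from the root, not from \<open>v\<close>, so that
  ancestors of different vertices can be compared level by level.\<close>

definition "anc m v = (par ^^ (dep v - m)) v"

lemma connected: "connected_graph V E"
  using tree by (simp add: simplicial_tree_def)

lemma edgeD: "{u, v} \<in> E \<Longrightarrow> u \<in> V \<and> v \<in> V \<and> u \<noteq> v"
  using connected unfolding connected_graph_def simple_graph_def by (fastforce simp: doubleton_eq_iff)

lemma ed_commute: "ed u v = ed v u"
  using Metric_space.commute[OF Metric_space_graph[OF connected]] by simp

lemma ed_triangle: "u \<in> V \<Longrightarrow> v \<in> V \<Longrightarrow> w \<in> V \<Longrightarrow> ed u w \<le> ed u v + ed v w"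
  using Metric_space.triangle[OF Metric_space_graph[OF connected], of u v w]
  by (metis of_nat_add of_nat_le_iff)

lemma ed_eq_0: "u \<in> V \<Longrightarrow> v \<in> V \<Longrightarrow> ed u v = 0 \<longleftrightarrow> u = v"
  using Metric_space.zero[OF Metric_space_graph[OF connected], of u v] by simp

lemma ed_edge: "{u, v} \<in> E \<Longrightarrow> ed u v \<le> 1"
  using edgeD by (intro edge_path_dist_le[of V E "[u, v]"]) (auto simp: walk_def)

lemma dep_root: "dep root = 0"
  using ed_eq_0[OF root root] by (simp add: dep_def)

lemma dep_eq_0: "v \<in> V \<Longrightarrow> dep v = 0 \<longleftrightarrow> v = root"
  using ed_eq_0[OF root] by (auto simp: dep_def)

lemma dep_le: "u \<in> V \<Longrightarrow> v \<in> V \<Longrightarrow> dep v \<le> dep u + ed u v"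
  unfolding dep_def by (rule ed_triangle[OF root])

text \<open>The penultimate vertex of a shortest walk from the root witnesses the choice.\<close>

lemma par:
  assumes "v \<in> V" "dep v > 0"
  shows "par v \<in> V \<and> {par v, v} \<in> E \<and> dep v = Suc (dep (par v))"
proof -
  obtain p where p: "walk V E p" "hd p = root" "last p = v" "length p = Suc (dep v)"
    using edge_path_dist_walk[OF connected root \<open>v \<in> V\<close>] unfolding dep_def by metis
  define q where "q = butlast p"
  have "p \<noteq> []" using p by auto
  then have pq: "p = q @ [v]" using p q_def append_butlast_last_id by metis
  have "length q = dep v" using p pq by simp
  then have "q \<noteq> []" using assms by auto
  have q: "walk V E q" "hd q = root" and e: "{last q, v} \<in> E" "last q \<in> V"
    using p \<open>q \<noteq> []\<close> unfolding pq by (auto simp: walk_def successively_append_iff)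
  have "dep (last q) \<le> dep v - 1"
    unfolding dep_def using q \<open>length q = dep v\<close> assms
    by (intro edge_path_dist_le[of V E q]) (auto simp: dep_def)
  moreover have "dep v \<le> dep (last q) + 1"
    using dep_le[of "last q" v] ed_edge e assms by fastforce
  ultimately have "last q \<in> V \<and> {last q, v} \<in> E \<and> dep v = Suc (dep (last q))"
    using e assms by linarith
  then show ?thesis unfolding par_def by (rule someI)
qed

text \<open>Otherwise climbing to the root from \<open>u\<close> and from \<open>v\<close> never
  uses the edge, so its ends stay connected after its removal, although it is a bridge.\<close>

lemma edge_par:
  assumes e: "{u, v} \<in> E"
  shows "(dep v > 0 \<and> u = par v) \<or> (dep u > 0 \<and> v = par u)"
proof (rule ccontr)
  assume no: "\<not> ?thesis"
  let ?R = "{(x, y). x \<in> V \<and> y \<in> V \<and> {x, y} \<in> E - {{u, v}}}"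
  have up: "(w, root) \<in> ?R\<^sup>*" if "w \<in> V" for w
    using that
  proof (induction "dep w" arbitrary: w)
    case 0
    then show ?case using dep_eq_0[of w] by auto
  next
    case (Suc n)
    then have "(w, par w) \<in> ?R" using par[of w] no
      by (auto simp: doubleton_eq_iff insert_commute)
    moreover have "(par w, root) \<in> ?R\<^sup>*" using Suc par[of w] by auto
    ultimately show ?case by (rule converse_rtrancl_into_rtrancl)
  qed
  have "sym ?R" by (auto simp: sym_def insert_commute)
  then have "(root, v) \<in> ?R\<^sup>*" using up[of v] edgeD[OF e] by (meson sym_rtrancl symD)
  then have "(u, v) \<in> ?R\<^sup>*" using up[of u] edgeD[OF e] by (meson rtrancl_trans)
  then show False using acyclic_edge_is_bridge[OF tree e] edgeD[OF e] by blast
qed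

lemma funpow_par:
  assumes "v \<in> V" "j \<le> dep v"
  shows "(par ^^ j) v \<in> V \<and> dep ((par ^^ j) v) = dep v - j \<and> ed v ((par ^^ j) v) \<le> j"
  using assms(2)
proof (induction j)
  case 0
  then show ?case using assms ed_eq_0 by auto
next
  case (Suc j)
  let ?w = "(par ^^ j) v"
  have w: "?w \<in> V" "dep ?w = dep v - j" "ed v ?w \<le> j" using Suc by auto
  have p: "par ?w \<in> V" "{par ?w, ?w} \<in> E" "dep ?w = Suc (dep (par ?w))" using par[of ?w] w Suc by auto
  have "ed v (par ?w) \<le> ed v ?w + ed ?w (par ?w)" using w p assms by (intro ed_triangle) auto
  then show ?case using w p ed_edge[of ?w "par ?w"] by (auto simp: insert_commute)
qed

lemma anc:
  assumes "v \<in> V" "m \<le> dep v"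
  shows "anc m v \<in> V" "dep (anc m v) = m" "ed v (anc m v) \<le> dep v - m"
  using funpow_par[of v "dep v - m"] assms by (auto simp: anc_def)

lemma anc_self: "anc (dep v) v = v"
  by (simp add: anc_def)

lemma anc_anc:
  assumes "v \<in> V" "m \<le> m'" "m' \<le> dep v"
  shows "anc m (anc m' v) = anc m v"
proof -
  have "dep v - m = (m' - m) + (dep v - m')" using assms by auto
  then show ?thesis using anc(2)[OF assms(1,3)] by (simp add: anc_def funpow_add)
qed

lemma anc_par: "v \<in> V \<Longrightarrow> m < dep v \<Longrightarrow> anc m (par v) = anc m v"
  using par[of v] Suc_diff_le[of m "dep (par v)"] by (simp add: anc_def funpow_swap1)

text \<open>The walk is too short to climb above depth \<open>m\<close>. Every step starts strictly
  below that depth and goes to a parent or to a child, which keeps the ancestor at depth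
  \<open>m\<close>.\<close>

lemma anc_cong_walk:
  assumes "walk V E p" "m + length p \<le> Suc (dep (hd p))"
  shows "m \<le> dep (last p) \<and> anc m (last p) = anc m (hd p)"
  using assms
proof (induction p)
  case Nil
  then show ?case by (simp add: walk_def)
next
  case (Cons u p)
  show ?case
  proof (cases "p = []")
    case True
    then show ?thesis using Cons by simp
  next
    case False
    then have w: "walk V E p" and e: "{u, hd p} \<in> E" "u \<in> V" "hd p \<in> V"
      using Cons.prems by (auto simp: walk_def successively_Cons)
    have d: "dep u \<le> dep (hd p) + 1" using dep_le[of "hd p" u] ed_edge[OF e(1)] e by (simp add: ed_commute)
    have "length p > 0" using False by simp
    have l: "m + length p \<le> dep u" using Cons.prems by simp
    have "m \<le> dep (last p) \<and> anc m (last p) = anc m (hd p)"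
      using Cons.IH[OF w] l d by simp
    moreover have "anc m (hd p) = anc m u"
      using edge_par[OF e(1)]
    proof
      assume h: "dep (hd p) > 0 \<and> u = par (hd p)"
      then have "m < dep (hd p)" using par[of "hd p"] e l by auto
      then show ?thesis using anc_par e h by simp
    next
      assume "dep u > 0 \<and> hd p = par u"
      then show ?thesis using anc_par[of u m] e l \<open>length p > 0\<close> by simp
    qed
    ultimately show ?thesis using False by simp
  qed
qed

lemma anc_cong:
  assumes "u \<in> V" "v \<in> V" "m + ed u v \<le> dep u"
  shows "m \<le> dep v" "anc m v = anc m u"
proof -
  obtain p where "walk V E p" "hd p = u" "last p = v" "length p = Suc (ed u v)"
    using edge_path_dist_walk[OF connected assms(1,2)] by metis
  then show "m \<le> dep v" "anc m v = anc m u" using anc_cong_walk[of p m] assms by auto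
qed

end

section \<open>Tree structures on quasi-trees\<close>

lemma ex_step_change:
  fixes P :: "nat \<Rightarrow> bool"
  assumes "P 0 \<noteq> P n"
  shows "\<exists>k<n. P k \<noteq> P (Suc k)"
  using assms by (induction n) (auto simp: less_Suc_eq)

lemma mdist_self [simp]: "x \<in> mspace M \<Longrightarrow> mdist M x x = 0"
  by (simp add: mdist_zero)

text \<open>\<open>A x\<close> is the set of ancestors of \<open>x\<close>, including \<open>x\<close> itself but excluding the root \<open>x0\<close>.
  The tree distance of \<open>x\<close> and \<open>y\<close> is therefore the number of elements of exactly one of \<open>A x\<close>, \<open>A y\<close>.\<close>

locale coarse_tree =
  fixes M :: "'a metric" and x0 :: 'a and par :: "'a \<Rightarrow> 'a" and A :: "'a \<Rightarrow> 'a set" and r L :: real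
  assumes base_in: "x0 \<in> mspace M"
    and r_nonneg: "0 \<le> r" and L_nonneg: "0 \<le> L"
    and finite_A: "x \<in> mspace M \<Longrightarrow> finite (A x)"
    and A_base: "A x0 = {}"
    and par_in: "x \<in> mspace M \<Longrightarrow> x \<noteq> x0 \<Longrightarrow> par x \<in> mspace M"
    and par_dist: "x \<in> mspace M \<Longrightarrow> x \<noteq> x0 \<Longrightarrow> mdist M x (par x) \<le> r"
    and A_par: "x \<in> mspace M \<Longrightarrow> x \<noteq> x0 \<Longrightarrow> A x = insert x (A (par x))"
    and notin_A_par: "x \<in> mspace M \<Longrightarrow> x \<noteq> x0 \<Longrightarrow> x \<notin> A (par x)"
    and card_A_diff: "x \<in> mspace M \<Longrightarrow> y \<in> mspace M \<Longrightarrow> real (card (A x - A y)) \<le> L * mdist M x y + L"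
begin

section \<open>Climbing to the root in a coarse tree\<close>

lemma card_A: "x \<in> mspace M \<Longrightarrow> x \<noteq> x0 \<Longrightarrow> card (A x) = Suc (card (A (par x)))"
  using A_par[of x] notin_A_par[of x] finite_A[OF par_in, of x] by simp

lemma par_induct [consumes 1, case_names base par]:
  assumes "x \<in> mspace M" and "P x0"
    and "\<And>x. x \<in> mspace M \<Longrightarrow> x \<noteq> x0 \<Longrightarrow> par x \<in> mspace M \<Longrightarrow> P (par x) \<Longrightarrow> P x"
  shows "P x"
  using assms(1)
proof (induction "card (A x)" arbitrary: x rule: less_induct)
  case less
  then show ?case using card_A[of x] par_in[of x] assms(2,3) by (cases "x = x0") auto
qed

lemma A_subset: "x \<in> mspace M \<Longrightarrow> A x \<subseteq> mspace M - {x0}"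
  by (induction rule: par_induct) (auto simp: A_base A_par)

lemma in_A_self: "x \<in> mspace M \<Longrightarrow> x \<noteq> x0 \<Longrightarrow> x \<in> A x"
  by (simp add: A_par)

lemma A_trans: "x \<in> mspace M \<Longrightarrow> z \<in> A x \<Longrightarrow> A z \<subseteq> A x"
proof (induction rule: par_induct)
  case base
  then show ?case by (simp add: A_base)
next
  case (par x)
  then show ?case using A_par[of x] by auto
qed

text \<open>Depth strictly increases from an ancestor to its descendants. This serves to show that
  the deeper end of a geodesic starts by going to its parent.\<close>

lemma not_in_A_of_card_le:
  assumes "x \<in> mspace M" "y \<in> mspace M" "x \<noteq> y" "card (A y) \<le> card (A x)"
  shows "x \<noteq> x0" "x \<notin> A y"
proof -
  show *: "x \<noteq> x0"
  proof
    assume "x = x0"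
    then have "card (A y) = 0" using assms by (simp add: A_base)
    then show False using card_A[of y] assms \<open>x = x0\<close> by auto
  qed
  show "x \<notin> A y"
  proof
    assume "x \<in> A y"
    moreover have y: "y \<noteq> x0" using \<open>x \<in> A y\<close> A_base by auto
    ultimately have "x \<in> A (par y)" using assms A_par by auto
    then have "card (A x) \<le> card (A (par y))"
      using A_trans assms y par_in finite_A by (intro card_mono) auto
    then show False using card_A[of y] assms y by simp
  qed
qed

text \<open>No vertex between \<open>x\<close> and \<open>z\<close> is an ancestor of
  \<open>y\<close>, since \<open>z\<close> would then be one too. Hence the climb from
  \<open>x\<close> to \<open>z\<close> stays in \<open>A x - A y\<close>, with steps of length at
  most \<open>r\<close>.\<close>

lemma dist_A_le:
  assumes "x \<in> mspace M" "y \<in> mspace M" "z \<in> A x" "z \<notin> A y"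
  shows "mdist M x z \<le> r * card (A x - A y)"
  using assms(1,3)
proof (induction rule: par_induct)
  case base
  then show ?case by (simp add: A_base)
next
  case (par x)
  show ?case
  proof (cases "z = x")
    case True
    then show ?thesis using par r_nonneg by simp
  next
    case False
    then have z: "z \<in> A (par x)" using par A_par by auto
    then have zM: "z \<in> mspace M" using par A_subset by auto
    have "x \<notin> A y" using A_trans[of y x] assms \<open>z \<in> A x\<close> by auto
    then have "A x - A y = insert x (A (par x) - A y)" using A_par par by auto
    then have "card (A x - A y) = Suc (card (A (par x) - A y))"
      using notin_A_par par finite_A by simp
    moreover have "mdist M (par x) z \<le> r * card (A (par x) - A y)" using par z by simp
    moreover have "mdist M x z \<le> mdist M x (par x) + mdist M (par x) z"
      using par zM by (intro mdist_triangle) auto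
    ultimately show ?thesis using par_dist[of x] par by (simp add: algebra_simps)
  qed
qed

lemma dist_base_le: "x \<in> mspace M \<Longrightarrow> mdist M x x0 \<le> r * card (A x)"
proof (induction rule: par_induct)
  case base
  then show ?case using base_in by (simp add: A_base)
next
  case (par x)
  moreover have "mdist M x x0 \<le> mdist M x (par x) + mdist M (par x) x0"
    using par base_in by (intro mdist_triangle) auto
  ultimately show ?case using par_dist[of x] card_A[of x] by (simp add: algebra_simps)
qed

text \<open>If \<open>z\<close> separates two nearby points, both are near \<open>z\<close>. The
  last summand \<rho> covers the case where \<open>z\<close> lies above \<open>y\<close> rather than
  above \<open>x\<close>.\<close>

lemma dist_crossing_le:
  assumes "x \<in> mspace M" "y \<in> mspace M" "mdist M x y \<le> \<rho>" "(z \<in> A x) \<noteq> (z \<in> A y)"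
  shows "mdist M x z \<le> r * (L * \<rho> + L) + \<rho>"
proof -
  have *: "mdist M u z \<le> r * (L * \<rho> + L)"
    if "u \<in> mspace M" "v \<in> mspace M" "mdist M u v \<le> \<rho>" "z \<in> A u" "z \<notin> A v" for u v
  proof -
    have "mdist M u z \<le> r * card (A u - A v)" using that dist_A_le by blast
    also have "\<dots> \<le> r * (L * mdist M u v + L)"
      using card_A_diff that r_nonneg by (intro mult_left_mono) auto
    also have "\<dots> \<le> r * (L * \<rho> + L)"
      using that r_nonneg L_nonneg by (intro mult_left_mono add_right_mono) auto
    finally show ?thesis .
  qed
  have \<rho>: "\<rho> \<ge> 0" using assms(3) mdist_nonneg[of M x y] by linarith
  show ?thesis
  proof (cases "z \<in> A x")
    case True
    then show ?thesis using *[of x y] assms \<rho> by simp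
  next
    case False
    then have "z \<in> A y" using assms by simp
    moreover have "z \<in> mspace M" using \<open>z \<in> A y\<close> A_subset assms by auto
    ultimately show ?thesis
      using *[of y x] assms False mdist_triangle[of x M y z] by (simp add: mdist_commute)
  qed
qed

text \<open>The set \<open>A u - A v \<union> (A v - A u)\<close> lists the vertices of the geodesic from \<open>u\<close> to \<open>v\<close>,
  except for its topmost vertex. Hence the bound \<open>2 * r\<close> rather than \<open>r\<close>.\<close>

lemma geodesic_cover:
  assumes "u \<in> mspace M" "v \<in> mspace M" "u \<in> P" "v \<in> Q"
    and "\<And>z. (z \<in> A u) \<noteq> (z \<in> A v) \<Longrightarrow> z \<in> P \<or> z \<in> Q"
  shows "\<exists>x\<in>P. \<exists>y\<in>Q. x \<in> mspace M \<and> y \<in> mspace M \<and> mdist M x y \<le> 2 * r"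
  using assms
proof (induction "card (A u) + card (A v)" arbitrary: u v P Q rule: less_induct)
  case less
  \<comment> \<open>The deeper end moves to its parent. The induction hypothesis is a premise here,
    so that the argument serves for either end being the deeper one.\<close>
  have main: "\<exists>x\<in>P. \<exists>y\<in>Q. x \<in> mspace M \<and> y \<in> mspace M \<and> mdist M x y \<le> 2 * r"
    if IH: "\<And>u'. card (A u') < card (A u) \<Longrightarrow> u' \<in> mspace M \<Longrightarrow> u' \<in> P \<Longrightarrow>
        (\<And>z. (z \<in> A u') \<noteq> (z \<in> A v) \<Longrightarrow> z \<in> P \<or> z \<in> Q) \<Longrightarrow>
        \<exists>x\<in>P. \<exists>y\<in>Q. x \<in> mspace M \<and> y \<in> mspace M \<and> mdist M x y \<le> 2 * r"
      and uv: "u \<in> mspace M" "v \<in> mspace M" "u \<in> P" "v \<in> Q" "u \<noteq> v" "card (A v) \<le> card (A u)"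
      and cov: "\<And>z. (z \<in> A u) \<noteq> (z \<in> A v) \<Longrightarrow> z \<in> P \<or> z \<in> Q" for u v P Q
  proof -
    have u: "u \<noteq> x0" "u \<notin> A v" using not_in_A_of_card_le uv by auto
    let ?p = "par u"
    have p: "?p \<in> mspace M" "mdist M u ?p \<le> r" "A u = insert u (A ?p)" "card (A u) = Suc (card (A ?p))"
      using par_in par_dist A_par card_A u uv by auto
    consider "?p \<in> P" | "?p \<in> Q" | "?p \<notin> P" "?p \<notin> Q" by blast
    then show ?thesis
    proof cases
      case 1
      show ?thesis
      proof (rule IH[of ?p])
        show "z \<in> P \<or> z \<in> Q" if "(z \<in> A ?p) \<noteq> (z \<in> A v)" for z
          using that cov[of z] p(3) uv(3) by auto
      qed (use p 1 in auto)
    next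
      case 2
      moreover have "mdist M u ?p \<le> 2 * r" using p(2) r_nonneg by linarith
      ultimately show ?thesis using uv p(1) by blast
    next
      case 3
      \<comment> \<open>An uncovered parent of \<open>u\<close> must be the topmost vertex of the
        geodesic. As \<open>v\<close> is no deeper than \<open>u\<close>, it is that vertex or one
        of its children, so two steps connect \<open>u\<close> to \<open>v\<close>.\<close>
      then have *: "?p = x0 \<or> ?p \<in> A v" using cov[of ?p] in_A_self[of ?p] p by auto
      then have sub: "A ?p \<subseteq> A v" using A_trans[of v ?p] uv A_base by auto
      have "mdist M ?p v \<le> r"
      proof (cases "v = ?p")
        case True
        then show ?thesis using p r_nonneg by simp
      next
        case False
        then have v: "v \<noteq> x0" using * A_base by auto
        have "A ?p \<subseteq> A (par v)"
        proof (cases "?p = x0")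
          case False
          then have "?p \<in> A (par v)" using * A_par[OF uv(2) v] \<open>v \<noteq> ?p\<close> by auto
          then show ?thesis using A_trans par_in uv v by blast
        qed (simp add: A_base)
        moreover have "?p = x0 \<or> ?p \<in> A (par v)"
          using * A_par[OF uv(2) v] \<open>v \<noteq> ?p\<close> by auto
        moreover have "card (A (par v)) \<le> card (A ?p)" using card_A[OF uv(2) v] p uv by simp
        ultimately have "?p = par v"
          using not_in_A_of_card_le[of ?p "par v"] p par_in[OF uv(2) v] by auto
        then show ?thesis using par_dist[OF uv(2) v] by (simp add: mdist_commute)
      qed
      then have "mdist M u v \<le> 2 * r"
        using mdist_triangle[of u M ?p v] uv p by simp
      then show ?thesis using uv by blast
    qed
  qed
  consider "u = v" | "u \<noteq> v" "card (A v) \<le> card (A u)" | "u \<noteq> v" "card (A u) \<le> card (A v)" by linarith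
  then show ?case
  proof cases
    case 1
    then show ?thesis using less.prems r_nonneg by (intro bexI[of _ u] bexI[of _ u]) auto
  next
    case 2
    show ?thesis
    proof (rule main[where u = u and v = v and P = P and Q = Q])
      fix u' assume u': "card (A u') < card (A u)" "u' \<in> mspace M" "u' \<in> P"
        "\<And>z. (z \<in> A u') \<noteq> (z \<in> A v) \<Longrightarrow> z \<in> P \<or> z \<in> Q"
      show "\<exists>x\<in>P. \<exists>y\<in>Q. x \<in> mspace M \<and> y \<in> mspace M \<and> mdist M x y \<le> 2 * r"
        by (rule less.hyps[where u = u' and v = v]) (use u' less.prems in auto)
    qed (use 2 less.prems in auto)
  next
    case 3
    have "\<exists>x\<in>Q. \<exists>y\<in>P. x \<in> mspace M \<and> y \<in> mspace M \<and> mdist M x y \<le> 2 * r"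
    proof (rule main[where u = v and v = u and P = Q and Q = P])
      fix v' assume v': "card (A v') < card (A v)" "v' \<in> mspace M" "v' \<in> Q"
        "\<And>z. (z \<in> A v') \<noteq> (z \<in> A u) \<Longrightarrow> z \<in> Q \<or> z \<in> P"
      have "\<exists>x\<in>P. \<exists>y\<in>Q. x \<in> mspace M \<and> y \<in> mspace M \<and> mdist M x y \<le> 2 * r"
        by (rule less.hyps[where u = u and v = v']) (use v' less.prems in auto)
      then show "\<exists>x\<in>Q. \<exists>y\<in>P. x \<in> mspace M \<and> y \<in> mspace M \<and> mdist M x y \<le> 2 * r"
        by (metis mdist_commute)
    qed (use 3 less.prems in auto)
    then show ?thesis by (metis mdist_commute)
  qed
qed

lemma coarsely_connected:
  assumes "a \<in> mspace M" "b \<in> mspace M"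
  obtains n \<alpha> where "\<alpha> 0 = a" "\<alpha> n = b" "\<And>k. \<alpha> k \<in> mspace M"
    "\<And>k. k < n \<Longrightarrow> mdist M (\<alpha> k) (\<alpha> (Suc k)) \<le> r"
proof -
  let ?R = "{(x, y). x \<in> mspace M \<and> y \<in> mspace M \<and> mdist M x y \<le> r}"
  have to_base: "(x, x0) \<in> ?R\<^sup>*" if "x \<in> mspace M" for x
    using that
  proof (induction rule: par_induct)
    case (par x)
    then have "(x, par x) \<in> ?R" using par_dist by auto
    then show ?case using par by (meson converse_rtrancl_into_rtrancl)
  qed simp
  have "sym ?R" by (auto simp: sym_def mdist_commute)
  then have "(x0, b) \<in> ?R\<^sup>*" using to_base[OF assms(2)] by (meson sym_rtrancl symD)
  then have "(a, b) \<in> ?R\<^sup>*" using to_base[OF assms(1)] by (meson rtrancl_trans)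
  then obtain n where "(a, b) \<in> ?R ^^ n" by (meson rtrancl_imp_relpow)
  then obtain f where f: "f 0 = a" "f n = b" "\<forall>i<n. (f i, f (Suc i)) \<in> ?R"
    unfolding relpow_fun_conv by blast
  have "f k \<in> mspace M" if "k \<le> n" for k
    using f assms that by (cases "k = n") auto
  \<comment> \<open>Freezing the path at its end keeps all indices inside the space.\<close>
  then have "f (min k n) \<in> mspace M" for k by auto
  then show ?thesis using f by (intro that[of "\<lambda>k. f (min k n)" n]) (auto simp: min_def)
qed

text \<open>If \<open>z\<close> separates two vertices of the rectangle, then both ways around the rectangle cross the edge
  above \<open>z\<close>, so two points on different sides are close to \<open>z\<close>. When the second side is long, this
  forces \<open>z\<close> to be near an end of the first one.\<close>

lemma rectangle_side_le:
  assumes F: "\<And>k l. F k l \<in> mspace M"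
    and rect: "\<And>k k' l l'. mdist M (F k l) (F k' l') = mdist M (F k 0) (F k' 0) + mdist M (F 0 l) (F 0 l')"
    and step1: "\<And>k. k < m \<Longrightarrow> mdist M (F k 0) (F (Suc k) 0) \<le> \<rho>"
    and step2: "\<And>l. l < n \<Longrightarrow> mdist M (F 0 l) (F 0 (Suc l)) \<le> \<rho>"
    and K1: "K1 = r * (L * \<rho> + L) + \<rho>" and "\<rho> \<ge> 0"
  shows "mdist M (F 0 0) (F m 0) \<le> 6 * K1 + 2 * r \<or> mdist M (F 0 0) (F 0 n) \<le> 2 * K1"
proof (rule ccontr)
  assume neg: "\<not> ?thesis"
  have K1_0: "K1 \<ge> 0" using K1 \<open>\<rho> \<ge> 0\<close> r_nonneg L_nonneg by simp
  \<comment> \<open>Two balls of radius \<open>3 * K1\<close> that cover the geodesic between the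
    corners come within \<open>2 * r\<close> of each other; this yields the bound
    \<open>6 * K1 + 2 * r\<close>.\<close>
  let ?P = "\<lambda>u. {x. mdist M u x \<le> 3 * K1}"
  let ?u = "F 0 0" and ?v = "F m 0"
  have "\<exists>x\<in>?P ?u. \<exists>y\<in>?P ?v. x \<in> mspace M \<and> y \<in> mspace M \<and> mdist M x y \<le> 2 * r"
  proof (rule geodesic_cover)
    show "F 0 0 \<in> mspace M" "F m 0 \<in> mspace M" by (rule F)+
    show "?u \<in> ?P ?u" "?v \<in> ?P ?v" using K1_0 F by auto
    fix z assume z: "(z \<in> A ?u) \<noteq> (z \<in> A ?v)"
    then have zM: "z \<in> mspace M" using A_subset F by blast
    obtain k where k: "k < m" "(z \<in> A (F k 0)) \<noteq> (z \<in> A (F (Suc k) 0))"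
      using ex_step_change[of "\<lambda>k. z \<in> A (F k 0)" m] z by blast
    have kz: "mdist M (F k 0) z \<le> K1" unfolding K1 using k step1 F dist_crossing_le by blast
    have near: "mdist M (F k' l) (F k 0) \<le> 2 * K1" if "mdist M (F k' l) z \<le> K1" for k' l
      using mdist_triangle[of "F k' l" M z "F k 0"] kz that F zM mdist_commute[of M z "F k 0"] by simp
    have step2': "mdist M (F k l) (F k (Suc l)) \<le> \<rho>" if "l < n" for k l
      using rect[of k l k "Suc l"] step2[OF that] F by simp
    have step1': "mdist M (F k n) (F (Suc k) n) \<le> \<rho>" if "k < m" for k
      using rect[of k n "Suc k" n] step1[OF that] F by simp
    have near_end: "mdist M w z \<le> 3 * K1"
      if w: "w = F j 0" and d: "mdist M (F k 0) (F j 0) \<le> 2 * K1" for w j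
      using mdist_triangle[of w M "F k 0" z] kz d F zM w mdist_commute[of M w "F k 0"] by simp
    \<comment> \<open>The other three sides form a second path between the same corners, so one of
      them crosses \<open>z\<close> as well. A crossing on an adjacent side puts \<open>z\<close>
      near that corner; one on the opposite side makes the second side short.\<close>
    consider "(z \<in> A ?u) \<noteq> (z \<in> A (F 0 n))" | "(z \<in> A (F m 0)) \<noteq> (z \<in> A (F m n))"
      | "(z \<in> A (F 0 n)) \<noteq> (z \<in> A (F m n))" using z by blast
    then show "z \<in> ?P ?u \<or> z \<in> ?P ?v"
    proof cases
      case 1
      then obtain l where l: "l < n" "(z \<in> A (F 0 l)) \<noteq> (z \<in> A (F 0 (Suc l)))"
        using ex_step_change[of "\<lambda>l. z \<in> A (F 0 l)" n] by blast
      then have "mdist M (F 0 l) z \<le> K1" unfolding K1 using step2' F dist_crossing_le by blast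
      then have "mdist M (F 0 l) (F k 0) \<le> 2 * K1" by (rule near)
      then have "mdist M (F k 0) (F 0 0) \<le> 2 * K1"
        using rect[of 0 l k 0] mdist_nonneg[of M "F 0 l" "F 0 0"]
          mdist_commute[of M "F 0 0" "F k 0"] by linarith
      then show ?thesis using near_end by simp
    next
      case 2
      then obtain l where l: "l < n" "(z \<in> A (F m l)) \<noteq> (z \<in> A (F m (Suc l)))"
        using ex_step_change[of "\<lambda>l. z \<in> A (F m l)" n] by blast
      then have "mdist M (F m l) z \<le> K1" unfolding K1 using step2' F dist_crossing_le by blast
      then have "mdist M (F m l) (F k 0) \<le> 2 * K1" by (rule near)
      then have "mdist M (F k 0) (F m 0) \<le> 2 * K1"
        using rect[of m l k 0] mdist_nonneg[of M "F 0 l" "F 0 0"]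
          mdist_commute[of M "F m 0" "F k 0"] by linarith
      then show ?thesis using near_end by simp
    next
      case 3
      then obtain j where j: "j < m" "(z \<in> A (F j n)) \<noteq> (z \<in> A (F (Suc j) n))"
        using ex_step_change[of "\<lambda>j. z \<in> A (F j n)" m] by blast
      then have "mdist M (F j n) z \<le> K1" unfolding K1 using step1' F dist_crossing_le by blast
      then have "mdist M (F j n) (F k 0) \<le> 2 * K1" by (rule near)
      then have "mdist M (F 0 n) (F 0 0) \<le> 2 * K1"
        using rect[of j n k 0] mdist_nonneg[of M "F j 0" "F k 0"] by linarith
      then show ?thesis using neg by (simp add: mdist_commute)
    qed
  qed
  then obtain x y where "mdist M ?u x \<le> 3 * K1" "mdist M ?v y \<le> 3 * K1" "mdist M x y \<le> 2 * r"
    "x \<in> mspace M" "y \<in> mspace M" by auto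
  then have "mdist M ?u ?v \<le> 6 * K1 + 2 * r"
    using mdist_triangle[of ?u M x ?v] mdist_triangle[of x M y ?v] F by (simp add: mdist_commute)
  then show False using neg by simp
qed

end

context rooted_tree
begin

text \<open>Points are grouped into cells according to the last ancestor of \<open>g x\<close> at a depth divisible by \<open>k\<close>.
  Since \<open>k\<close> exceeds twice the density constant \<open>c\<close>, all cells above a nonempty cell are nonempty, so
  representatives of the nonempty cells form a tree. The other points are leaves attached to the
  representative of their cell.\<close>

lemma coarse_tree_of_quasi_isometry:
  fixes M :: "'a metric" and g :: "'a \<Rightarrow> 'v" and a :: real and c :: nat
  assumes x0: "x0 \<in> mspace M" "g x0 = root" and gV: "\<And>x. x \<in> mspace M \<Longrightarrow> g x \<in> V"
    and a: "a \<ge> 1"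
    and lower: "\<And>x y. x \<in> mspace M \<Longrightarrow> y \<in> mspace M \<Longrightarrow> 1 / a * mdist M x y - a \<le> ed (g x) (g y)"
    and upper: "\<And>x y. x \<in> mspace M \<Longrightarrow> y \<in> mspace M \<Longrightarrow> ed (g x) (g y) \<le> a * mdist M x y + a"
    and dense: "\<And>v. v \<in> V \<Longrightarrow> \<exists>x\<in>mspace M. ed v (g x) \<le> c"
  shows "\<exists>par A r L. coarse_tree M x0 par A r L"
proof -
  define k where "k = 2 * c + 2"
  define lev where "lev x = dep (g x) div k" for x
  define node where "node x m = anc (k * m) (g x)" for x m
  define cell where "cell x = node x (lev x)" for x
  \<comment> \<open>The root cell must be represented by \<open>x0\<close>, which becomes the root
    of the new tree.\<close>
  define h where "h v = (if v = root then x0 else SOME x. x \<in> mspace M \<and> cell x = v)" for v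
  \<comment> \<open>Level 0 is omitted because its representative is the root \<open>x0\<close>. A
    representative lists itself through its own level, any other point is added as a leaf.\<close>
  define A where "A x = (if x = h (cell x) then {} else {x}) \<union> (\<lambda>m. h (node x m)) ` {1..lev x}" for x
  define par where "par x = (if x = h (cell x) then h (node x (lev x - 1)) else h (cell x))" for x
  have k: "k > 0" by (simp add: k_def)
  have le_dep: "k * m \<le> dep (g x)" if "m \<le> lev x" for m x
    using that unfolding lev_def by (meson div_times_less_eq_dividend le_trans mult.commute mult_le_mono2 times_div_less_eq_dividend)
  have lev_x0: "lev x0 = 0" by (simp add: lev_def x0 dep_root)
  have cell_x0: "cell x0 = root"
    using anc_self[of root] by (simp add: cell_def node_def lev_x0 x0 dep_root)
  have node_V: "node x m \<in> V" "dep (node x m) = k * m" if "x \<in> mspace M" "m \<le> lev x" for x m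
    using anc[OF gV[OF that(1)] le_dep[OF that(2)]] by (auto simp: node_def)
  have node_ex: "\<exists>x'\<in>mspace M. cell x' = node x m \<and> lev x' = m" if x: "x \<in> mspace M" "m \<le> lev x" for x m
  proof (cases "m = lev x")
    case True
    then show ?thesis using x by (auto simp: cell_def)
  next
    case False
    then have "k * Suc m \<le> dep (g x)" using le_dep[of "Suc m" x] x by simp
    then have le: "k * m + c + 1 \<le> dep (g x)" by (simp add: k_def)
    \<comment> \<open>The ball of radius \<open>c\<close> around this vertex lies between the depths
      \<open>k * m + 1\<close> and \<open>k * m + 2 * c + 1\<close>, hence inside level
      \<open>m\<close>. This is the reason for \<open>k = 2 * c + 2\<close>.\<close>
    define w where "w = anc (k * m + c + 1) (g x)"
    have w: "w \<in> V" "dep w = k * m + c + 1" using anc[OF gV le] x by (auto simp: w_def)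
    obtain x' where x': "x' \<in> mspace M" "ed w (g x') \<le> c" using dense[OF w(1)] by blast
    have *: "k * m \<le> dep (g x')" "anc (k * m) (g x') = anc (k * m) w"
      using anc_cong[of w "g x'" "k * m"] w gV x' by auto
    have "dep (g x') < k * Suc m"
      using dep_le[of w "g x'"] w gV x' by (simp add: k_def)
    then have "lev x' = m"
      unfolding lev_def using *(1) k by (intro div_nat_eqI) (auto simp: mult.commute)
    moreover have "anc (k * m) w = node x m"
      unfolding w_def node_def using le x by (intro anc_anc gV) auto
    ultimately show ?thesis using x' * by (auto simp: cell_def node_def)
  qed
  have cell_root: "cell x = root \<longleftrightarrow> lev x = 0" if "x \<in> mspace M" for x
    using node_V[OF that, of "lev x"] dep_eq_0[of "cell x"] k by (auto simp: cell_def)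
  have h: "h (node x m) \<in> mspace M \<and> cell (h (node x m)) = node x m \<and> lev (h (node x m)) = m"
    if x: "x \<in> mspace M" "m \<le> lev x" for x m
  proof (cases "node x m = root")
    case True
    then have "m = 0" using node_V[OF x] dep_root k by simp
    then show ?thesis using True x0 cell_x0 lev_x0 by (simp add: h_def)
  next
    case False
    have ex: "\<exists>y. y \<in> mspace M \<and> cell y = node x m" using node_ex[OF x] by blast
    have h: "h (node x m) \<in> mspace M \<and> cell (h (node x m)) = node x m"
      using someI_ex[OF ex] False by (simp add: h_def)
    then have "k * lev (h (node x m)) = k * m"
      using node_V(2)[of "h (node x m)" "lev (h (node x m))"] node_V(2)[OF x]
      unfolding cell_def by (metis order_refl)
    then show ?thesis using h k by auto
  qed
  \<comment> \<open>A point in the cell \<open>node x m\<close> shares all higher nodes with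
    \<open>x\<close>, so the ancestor set of a representative is an initial part of that of
    \<open>x\<close>.\<close>
  have node_cong: "node y j = node x j"
    if x: "x \<in> mspace M" "y \<in> mspace M" "m \<le> lev x" "cell y = node x m" "lev y = m" "j \<le> m" for x y m j
  proof -
    have "node y j = anc (k * j) (cell y)"
      unfolding cell_def node_def using x le_dep[of "lev y" y]
      by (intro anc_anc[symmetric] gV) auto
    also have "\<dots> = node x j"
      unfolding x(4) node_def using x le_dep[of m x] by (intro anc_anc gV) auto
    finally show ?thesis .
  qed
  have hnode_cell: "h (cell y) = y" if "y = h (node x m)" "x \<in> mspace M" "m \<le> lev x" for x y m
    using h[OF that(2,3)] that(1) by simp
  have ed_cell: "ed (g x) (cell x) \<le> k" if "x \<in> mspace M" for x
  proof -
    have "ed (g x) (cell x) \<le> dep (g x) - k * lev x"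
      unfolding cell_def node_def by (rule anc(3)[OF gV[OF that] le_dep[OF order_refl]])
    also have "\<dots> \<le> k" using k unfolding lev_def by (simp add: minus_mult_div_eq_mod less_imp_le)
    finally show ?thesis .
  qed
  \<comment> \<open>The bound \<open>3 * k\<close> allows \<open>k\<close> from \<open>g x\<close>
    to its cell vertex, \<open>k\<close> to the cell vertex one level up, and \<open>k\<close> back
    to a representative.\<close>
  have par_props: "par x \<in> mspace M \<and> A x = insert x (A (par x)) \<and> x \<notin> A (par x) \<and> ed (g x) (g (par x)) \<le> 3 * k"
    if x: "x \<in> mspace M" "x \<noteq> x0" for x
  proof (cases "x = h (cell x)")
    case False
    have hx: "h (cell x) \<in> mspace M" "cell (h (cell x)) = cell x" "lev (h (cell x)) = lev x"
      using h[OF x(1) order_refl] by (auto simp: cell_def)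
    have "node (h (cell x)) j = node x j" if "j \<le> lev x" for j
      by (rule node_cong[of x _ "lev x"]) (use x hx that in \<open>auto simp: cell_def\<close>)
    then have A: "A (par x) = (\<lambda>m. h (node x m)) ` {1..lev x}"
      using False hx by (auto simp: A_def par_def)
    have "x \<notin> A (par x)" unfolding A using hnode_cell[of x x] x False by auto
    moreover have "A x = insert x (A (par x))" unfolding A using False by (simp add: A_def)
    moreover have "ed (g x) (g (h (cell x))) \<le> ed (g x) (cell x) + ed (cell x) (g (h (cell x)))"
      using x hx gV node_V by (intro ed_triangle) (auto simp: cell_def)
    ultimately show ?thesis using ed_cell[OF x(1)] ed_cell[OF hx(1)] hx False
      by (simp add: par_def ed_commute)
  next
    case True
    have l: "lev x \<noteq> 0" using True x cell_root h_def by metis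
    let ?m = "lev x - 1" and ?y = "h (node x (lev x - 1))"
    have y: "?y \<in> mspace M" "cell ?y = node x ?m" "lev ?y = ?m" using h[of x ?m] x by auto
    have "node ?y j = node x j" if "j \<le> ?m" for j
      by (rule node_cong[of x _ ?m]) (use x y that in auto)
    moreover have par: "par x = ?y" using True by (simp add: par_def)
    ultimately have A: "A (par x) = (\<lambda>m. h (node x m)) ` {1..?m}"
      using y by (auto simp: A_def)
    have "{1..lev x} = insert (lev x) {1..?m}" using l by auto
    then have "A x = insert x (A (par x))" unfolding A using True by (simp add: A_def cell_def)
    moreover have "x \<notin> A (par x)"
    proof
      assume "x \<in> A (par x)"
      then obtain m where m: "m \<in> {1..?m}" "x = h (node x m)" unfolding A by auto
      then have "lev x = m" using h[of x m] x by auto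
      then show False using m by auto
    qed
    moreover have "ed (cell x) (node x ?m) \<le> k"
    proof -
      have "node x ?m = anc (k * ?m) (cell x)"
        unfolding cell_def node_def using x le_dep[of "lev x" x]
        by (intro anc_anc[symmetric] gV) auto
      moreover have "ed (cell x) (anc (k * ?m) (cell x)) \<le> dep (cell x) - k * ?m"
        using node_V[OF x(1), of "lev x"] by (intro anc(3)) (auto simp: cell_def)
      moreover have "dep (cell x) - k * ?m = k"
        using node_V[OF x(1), of "lev x"] l by (simp add: cell_def algebra_simps flip: diff_mult_distrib2)
      ultimately show ?thesis by simp
    qed
    moreover have "ed (g x) (g ?y) \<le> ed (g x) (cell x) + ed (cell x) (g ?y)"
      using x y gV node_V by (intro ed_triangle) (auto simp: cell_def)
    moreover have "ed (cell x) (g ?y) \<le> ed (cell x) (node x ?m) + ed (node x ?m) (g ?y)"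
      using x y gV node_V by (intro ed_triangle) (auto simp: cell_def)
    ultimately show ?thesis
      using ed_cell[OF x(1)] ed_cell[OF y(1)] y by (simp add: par ed_commute)
  qed
  \<comment> \<open>Nodes at least \<open>ed (g x) (g y)\<close> above \<open>g x\<close> are shared
    with \<open>g y\<close>. Only that many of the lowest levels can differ, and the summand 1
    accounts for \<open>x\<close> itself.\<close>
  have card: "card (A x - A y) \<le> 1 + ed (g x) (g y)" if xy: "x \<in> mspace M" "y \<in> mspace M" for x y
  proof -
    let ?d = "ed (g x) (g y)"
    have "A x - A y \<subseteq> insert x ((\<lambda>m. h (node x m)) ` {lev x - ?d<..lev x})"
    proof
      fix z assume z: "z \<in> A x - A y"
      show "z \<in> insert x ((\<lambda>m. h (node x m)) ` {lev x - ?d<..lev x})"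
      proof (cases "z = x")
        case False
        then obtain m where m: "m \<in> {1..lev x}" "z = h (node x m)"
          using z by (auto simp: A_def split: if_splits)
        have "dep (g x) < k * m + ?d"
        proof (rule ccontr)
          assume "\<not> ?thesis"
          then have "k * m \<le> dep (g y)" "node y m = node x m"
            using anc_cong[of "g x" "g y" "k * m"] gV xy by (auto simp: node_def)
          moreover from this have "m \<le> lev y" using k by (simp add: lev_def less_eq_div_iff_mult_less_eq mult.commute)
          ultimately have "m \<in> {1..lev y}" "z = h (node y m)" using m by auto
          then have "z \<in> A y" unfolding A_def by blast
          then show False using z by simp
        qed
        also have "\<dots> \<le> (m + ?d) * k" using k by (simp add: algebra_simps)
        finally have "lev x < m + ?d" unfolding lev_def by (rule less_mult_imp_div_less)
        then show ?thesis using m by auto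
      qed simp
    qed
    then have "card (A x - A y) \<le> card (insert x ((\<lambda>m. h (node x m)) ` {lev x - ?d<..lev x}))"
      by (intro card_mono) auto
    also have "\<dots> \<le> 1 + card ((\<lambda>m. h (node x m)) ` {lev x - ?d<..lev x})"
      by (simp add: card_insert_if)
    also have "\<dots> \<le> 1 + card {lev x - ?d<..lev x}"
      by (rule add_left_mono) (simp add: card_image_le del: card_greaterThanAtMost)
    also have "\<dots> \<le> 1 + ?d" by simp
    finally show ?thesis .
  qed
  \<comment> \<open>The first constant inverts the lower quasi-isometry bound for a step of tree
    distance at most \<open>3 * k\<close>; the second is the upper bound plus one for the point
    itself.\<close>
  have "coarse_tree M x0 par A (a * (3 * real k + a)) (1 + a)"
  proof
    show "0 \<le> a * (3 * real k + a)" "0 \<le> 1 + a" using a by auto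
    show "finite (A x)" for x by (simp add: A_def)
    show "A x0 = {}" using lev_x0 cell_x0 by (simp add: A_def h_def)
    show "x0 \<in> mspace M" by (rule x0)
    fix x assume x: "x \<in> mspace M"
    show "real (card (A x - A y)) \<le> (1 + a) * mdist M x y + (1 + a)" if y: "y \<in> mspace M" for y
    proof -
      have "real (card (A x - A y)) \<le> 1 + real (ed (g x) (g y))"
        using card[OF x y] by linarith
      also have "\<dots> \<le> 1 + (a * mdist M x y + a)" using upper[OF x y] by simp
      also have "\<dots> \<le> (1 + a) * mdist M x y + (1 + a)" by (simp add: algebra_simps)
      finally show ?thesis .
    qed
    assume "x \<noteq> x0"
    note p = par_props[OF x this]
    show "par x \<in> mspace M" "A x = insert x (A (par x))" "x \<notin> A (par x)" using p by auto
    have "1 / a * mdist M x (par x) - a \<le> ed (g x) (g (par x))" using lower x p by blast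
    also have "\<dots> \<le> 3 * real k" using p by linarith
    finally have "1 / a * mdist M x (par x) \<le> 3 * real k + a" by simp
    then show "mdist M x (par x) \<le> a * (3 * real k + a)" using a by (simp add: field_simps)
  qed
  then show ?thesis by blast
qed

end

lemma quasi_tree_imp_coarse_tree:
  assumes "quasi_tree TYPE('v) M" "x0 \<in> mspace M"
  shows "\<exists>par A r L. coarse_tree M x0 par A r L"
proof -
  obtain V :: "'v set" and E g where t: "simplicial_tree V E" and q: "quasi_isometry M (graph_metric V E) g"
    using assms by (auto simp: quasi_tree_def)
  have con: "connected_graph V E" using t by (simp add: simplicial_tree_def)
  note gm = graph_metric_simps[OF con]
  from q obtain a :: real where a: "a \<ge> 1" and sub: "g ` mspace M \<subseteq> V"
    and qi: "\<forall>x1\<in>mspace M. \<forall>x2\<in>mspace M.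
          1 / a * mdist M x1 x2 - a \<le> edge_path_dist V E (g x1) (g x2) \<and>
          edge_path_dist V E (g x1) (g x2) \<le> a * mdist M x1 x2 + a"
    unfolding quasi_isometry_def quasi_isometric_embedding_def gm by blast
  from q obtain C where C: "\<forall>y\<in>V. mball_of (graph_metric V E) y C \<inter> g ` mspace M \<noteq> {}"
    unfolding quasi_isometry_def gm by blast
  interpret rooted_tree V E "g x0" using t sub assms by unfold_locales auto
  show ?thesis
  proof (rule coarse_tree_of_quasi_isometry[where g = g and a = a and c = "nat \<lceil>C\<rceil>"])
    fix v assume "v \<in> V"
    then obtain x where x: "x \<in> mspace M" "g x \<in> mball_of (graph_metric V E) v C" using C by blast
    then have "edge_path_dist V E v (g x) < C" by (simp add: in_mball_of gm)
    then show "\<exists>x\<in>mspace M. edge_path_dist V E v (g x) \<le> nat \<lceil>C\<rceil>" using x by (intro bexI[of _ x]) linarith+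
  qed (use assms sub a qi in auto)
qed

section \<open>Isometries of products of quasi-trees\<close>

text \<open>A sum of triangle inequalities is an equality only if every summand is.\<close>

lemma sum_dist_additive_coordinate:
  assumes "x \<in> (\<Pi>\<^sub>E i\<in>{1..N}. mspace (X i))" "y \<in> (\<Pi>\<^sub>E i\<in>{1..N}. mspace (X i))" "z \<in> (\<Pi>\<^sub>E i\<in>{1..N}. mspace (X i))"
    and "sum_dist N X x z = sum_dist N X x y + sum_dist N X y z" "j \<in> {1..N}"
  shows "mdist (X j) (x j) (z j) = mdist (X j) (x j) (y j) + mdist (X j) (y j) (z j)"
proof (rule sum_mono_inv[where I = "{1..N}" and f = "\<lambda>j. mdist (X j) (x j) (z j)"])
  show "(\<Sum>j=1..N. mdist (X j) (x j) (z j)) = (\<Sum>j=1..N. mdist (X j) (x j) (y j) + mdist (X j) (y j) (z j))"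
    using assms(4) by (simp add: sum_dist_def sum.distrib)
  show "mdist (X i) (x i) (z i) \<le> mdist (X i) (x i) (y i) + mdist (X i) (y i) (z i)" if "i \<in> {1..N}" for i
    using PiE_mem[OF assms(1) that] PiE_mem[OF assms(2) that] PiE_mem[OF assms(3) that] by (rule mdist_triangle)
qed (use assms in auto)

locale product_isometry =
  fixes N :: nat and X :: "nat \<Rightarrow> 'a metric" and f :: "(nat \<Rightarrow> 'a) \<Rightarrow> (nat \<Rightarrow> 'a)"
  assumes f_in: "x \<in> (\<Pi>\<^sub>E i\<in>{1..N}. mspace (X i)) \<Longrightarrow> f x \<in> (\<Pi>\<^sub>E i\<in>{1..N}. mspace (X i))"
    and f_isometric: "x \<in> (\<Pi>\<^sub>E i\<in>{1..N}. mspace (X i)) \<Longrightarrow> y \<in> (\<Pi>\<^sub>E i\<in>{1..N}. mspace (X i)) \<Longrightarrow>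
      sum_dist N X (f x) (f y) = sum_dist N X x y"
begin

abbreviation "S \<equiv> \<Pi>\<^sub>E i\<in>{1..N}. mspace (X i)"

lemma f_coord: "x \<in> S \<Longrightarrow> j \<in> {1..N} \<Longrightarrow> f x j \<in> mspace (X j)"
  using f_in by (meson PiE_mem)

text \<open>The equality case of the four triangle inequalities shows that an isometry for the sum metric
  maps rectangles to rectangles in each coordinate separately.\<close>

lemma rectangle:
  assumes S: "x \<in> S" "y \<in> S" "x' \<in> S" "y' \<in> S"
    and rect: "\<And>i. i \<in> {1..N} \<Longrightarrow> (x i = y i \<and> x' i = y' i) \<or> (x i = x' i \<and> y i = y' i)"
    and j: "j \<in> {1..N}"
  shows "mdist (X j) (f x j) (f y' j) = mdist (X j) (f x j) (f y j) + mdist (X j) (f y j) (f y' j)"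
    and "mdist (X j) (f x j) (f y j) = mdist (X j) (f x' j) (f y' j)"
proof -
  have add: "mdist (X j) (f u j) (f w j) = mdist (X j) (f u j) (f v j) + mdist (X j) (f v j) (f w j)"
    if "u \<in> S" "v \<in> S" "w \<in> S" and *: "\<And>i. i \<in> {1..N} \<Longrightarrow> u i = v i \<or> v i = w i" for u v w
  proof (rule sum_dist_additive_coordinate[OF _ _ _ _ j])
    have "mdist (X i) (u i) (w i) = mdist (X i) (u i) (v i) + mdist (X i) (v i) (w i)" if i: "i \<in> {1..N}" for i
      using *[OF i] PiE_mem[OF \<open>v \<in> S\<close> i] by auto
    then have "sum_dist N X u w = sum_dist N X u v + sum_dist N X v w"
      by (simp add: sum_dist_def flip: sum.distrib)
    then show "sum_dist N X (f u) (f w) = sum_dist N X (f u) (f v) + sum_dist N X (f v) (f w)"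
      using that f_isometric by simp
  qed (use that f_in in auto)
  have 1: "mdist (X j) (f x j) (f y' j) = mdist (X j) (f x j) (f y j) + mdist (X j) (f y j) (f y' j)"
    by (rule add) (use S rect in blast)+
  have 2: "mdist (X j) (f x j) (f y' j) = mdist (X j) (f x j) (f x' j) + mdist (X j) (f x' j) (f y' j)"
    by (rule add) (use S rect in blast)+
  have 3: "mdist (X j) (f y j) (f x' j) = mdist (X j) (f y j) (f x j) + mdist (X j) (f x j) (f x' j)"
    by (rule add) (use S rect in metis)+
  have 4: "mdist (X j) (f y j) (f x' j) = mdist (X j) (f y j) (f y' j) + mdist (X j) (f y' j) (f x' j)"
    by (rule add) (use S rect in metis)+
  show "mdist (X j) (f x j) (f y' j) = mdist (X j) (f x j) (f y j) + mdist (X j) (f y j) (f y' j)" by (rule 1)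
  show "mdist (X j) (f x j) (f y j) = mdist (X j) (f x' j) (f y' j)"
    using 1 2 3 4 mdist_commute[of "X j" "f y j" "f x j"] mdist_commute[of "X j" "f y' j" "f x' j"] by linarith
qed

section \<open>Moving one coordinate at a time\<close>

lemma upd_in: "x \<in> S \<Longrightarrow> i \<in> {1..N} \<Longrightarrow> a \<in> mspace (X i) \<Longrightarrow> x(i := a) \<in> S"
  by (auto simp: PiE_iff extensional_def)

lemma dist_upd:
  assumes "x \<in> S" "i \<in> {1..N}" "a \<in> mspace (X i)" "b \<in> mspace (X i)"
  shows "sum_dist N X (x(i := a)) (x(i := b)) = mdist (X i) a b"
proof -
  have "sum_dist N X (x(i := a)) (x(i := b)) = (\<Sum>k=1..N. if k = i then mdist (X i) a b else 0)"
    unfolding sum_dist_def using PiE_mem[OF assms(1)] by (intro sum.cong) auto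
  then show ?thesis using assms(2) by simp
qed

lemma coord_le:
  assumes "x \<in> S" "y \<in> S" "j \<in> {1..N}"
  shows "mdist (X j) (f x j) (f y j) \<le> sum_dist N X x y"
proof -
  have "mdist (X j) (f x j) (f y j) \<le> sum_dist N X (f x) (f y)"
    unfolding sum_dist_def using assms by (intro member_le_sum) auto
  then show ?thesis using f_isometric assms by simp
qed

text \<open>Paths from \<open>z i\<close> to \<open>a\<close> and from \<open>z i'\<close> to
  \<open>b\<close> with steps at most \<rho> span a grid. Coordinate \<open>j\<close> of its image
  is a rectangle with small steps in a coarse tree, so one of its sides is short.\<close>

lemma two_active_directions:
  fixes K :: real
  assumes trees: "\<And>i. i \<in> {1..N} \<Longrightarrow> coarse_tree (X i) (o' i) (par i) (A i) (r i) (L i)"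
    and \<rho>: "\<And>i. i \<in> {1..N} \<Longrightarrow> r i \<le> \<rho>" "0 \<le> \<rho>"
    and K: "6 * (r j * (L j * \<rho> + L j) + \<rho>) + 2 * r j \<le> K"
    and j: "j \<in> {1..N}" and ii': "i \<in> {1..N}" "i' \<in> {1..N}" "i \<noteq> i'"
    and z: "z \<in> S" and a: "a \<in> mspace (X i)" and b: "b \<in> mspace (X i')"
  shows "mdist (X j) (f z j) (f (z(i := a)) j) \<le> K \<or> mdist (X j) (f z j) (f (z(i' := b)) j) \<le> K"
proof -
  interpret J: coarse_tree "X j" "o' j" "par j" "A j" "r j" "L j" using trees j .
  obtain m \<alpha> where \<alpha>: "\<alpha> 0 = z i" "\<alpha> m = a" "\<And>k. \<alpha> k \<in> mspace (X i)"
    "\<And>k. k < m \<Longrightarrow> mdist (X i) (\<alpha> k) (\<alpha> (Suc k)) \<le> r i"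
    using coarse_tree.coarsely_connected[OF trees[OF ii'(1)] PiE_mem[OF z ii'(1)] a] by metis
  obtain n \<beta> where \<beta>: "\<beta> 0 = z i'" "\<beta> n = b" "\<And>k. \<beta> k \<in> mspace (X i')"
    "\<And>k. k < n \<Longrightarrow> mdist (X i') (\<beta> k) (\<beta> (Suc k)) \<le> r i'"
    using coarse_tree.coarsely_connected[OF trees[OF ii'(2)] PiE_mem[OF z ii'(2)] b] by metis
  define w where "w k l = z(i := \<alpha> k, i' := \<beta> l)" for k l
  have w: "w k l \<in> S" for k l unfolding w_def by (intro upd_in z ii' \<alpha> \<beta>)
  have w0: "w k 0 = z(i := \<alpha> k)" "w 0 l = z(i' := \<beta> l)" for k l
    unfolding w_def using \<alpha>(1) \<beta>(1) ii' by (auto simp: fun_eq_iff)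
  let ?d = "\<lambda>x y. mdist (X j) (f x j) (f y j)"
  have rect: "?d (w k l) (w k' l') = ?d (w k l) (w k' l) + ?d (w k' l) (w k' l')" for k l k' l'
    by (rule rectangle(1)[where x' = "w k l'"]) (use w j in \<open>auto simp: w_def\<close>)
  have par1: "?d (w k l) (w k' l) = ?d (w k 0) (w k' 0)" for k l k'
    by (rule rectangle(2)) (use w j in \<open>auto simp: w_def\<close>)
  have par2: "?d (w k l) (w k l') = ?d (w 0 l) (w 0 l')" for k l l'
    by (rule rectangle(2)) (use w j in \<open>auto simp: w_def\<close>)
  let ?K1 = "r j * (L j * \<rho> + L j) + \<rho>"
  have "?d (w 0 0) (w m 0) \<le> 6 * ?K1 + 2 * r j \<or> ?d (w 0 0) (w 0 n) \<le> 2 * ?K1"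
  proof (rule J.rectangle_side_le[where F = "\<lambda>k l. f (w k l) j"])
    show "f (w k l) j \<in> mspace (X j)" for k l using f_coord w j by blast
    show "?d (w k l) (w k' l') = ?d (w k 0) (w k' 0) + ?d (w 0 l) (w 0 l')" for k k' l l'
      using rect par1 par2 by metis
    show "?d (w k 0) (w (Suc k) 0) \<le> \<rho>" if "k < m" for k
    proof -
      have "?d (w k 0) (w (Suc k) 0) \<le> mdist (X i) (\<alpha> k) (\<alpha> (Suc k))"
        using coord_le[OF w w j, of k 0 "Suc k" 0] dist_upd[OF z ii'(1) \<alpha>(3) \<alpha>(3)] by (simp add: w0)
      then show ?thesis using \<alpha>(4)[OF that] \<rho>(1)[OF ii'(1)] by linarith
    qed
    show "?d (w 0 l) (w 0 (Suc l)) \<le> \<rho>" if "l < n" for l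
    proof -
      have "?d (w 0 l) (w 0 (Suc l)) \<le> mdist (X i') (\<beta> l) (\<beta> (Suc l))"
        using coord_le[OF w w j, of 0 l 0 "Suc l"] dist_upd[OF z ii'(2) \<beta>(3) \<beta>(3)] by (simp add: w0)
      then show ?thesis using \<beta>(4)[OF that] \<rho>(1)[OF ii'(2)] by linarith
    qed
  qed (use \<rho> in auto)
  moreover have "w 0 0 = z" "w m 0 = z(i := a)" "w 0 n = z(i' := b)"
    using w0 \<alpha> \<beta> by auto
  moreover have "?K1 \<ge> 0" using J.r_nonneg J.L_nonneg \<rho> by simp
  ultimately show ?thesis using K J.r_nonneg by auto
qed

text \<open>At most one direction can displace coordinate \<open>j\<close> by more than
  \<open>K\<close>. All other coordinates are then changed one after the other, at cost
  \<open>K\<close> each.\<close>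

lemma coordinate_depends_on_one:
  fixes K :: real
  assumes trees: "\<And>i. i \<in> {1..N} \<Longrightarrow> coarse_tree (X i) (o' i) (par i) (A i) (r i) (L i)"
    and \<rho>: "\<And>i. i \<in> {1..N} \<Longrightarrow> r i \<le> \<rho>" "0 \<le> \<rho>"
    and K: "6 * (r j * (L j * \<rho> + L j) + \<rho>) + 2 * r j \<le> K"
    and j: "j \<in> {1..N}"
  shows "\<exists>i\<in>{1..N}. \<forall>x\<in>S. \<forall>y\<in>S. mdist (X j) (f x j) (f y j) \<le> mdist (X i) (x i) (y i) + real N * K"
proof -
  let ?d = "\<lambda>x y. mdist (X j) (f x j) (f y j)"
  define active where "active i \<longleftrightarrow> (\<exists>x\<in>S. \<exists>a\<in>mspace (X i). ?d x (x(i := a)) > K)" for i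
  interpret J: coarse_tree "X j" "o' j" "par j" "A j" "r j" "L j" using trees j .
  have "0 \<le> 6 * (r j * (L j * \<rho> + L j) + \<rho>) + 2 * r j"
    using J.r_nonneg J.L_nonneg \<rho>(2) by (intro add_nonneg_nonneg mult_nonneg_nonneg) auto
  then have K0: "K \<ge> 0" using K by (rule order_trans)
  have uniq: "i = i'" if act: "active i" "active i'" and ii': "i \<in> {1..N}" "i' \<in> {1..N}" for i i'
  proof (rule ccontr)
    assume ne: "i \<noteq> i'"
    obtain x a where x: "x \<in> S" "a \<in> mspace (X i)" "?d x (x(i := a)) > K" using act active_def by blast
    obtain y b where y: "y \<in> S" "b \<in> mspace (X i')" "?d y (y(i' := b)) > K" using act active_def by blast
    \<comment> \<open>Displacements of coordinate \<open>j\<close> agree on opposite sides of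
      rectangles, so both large displacements can be transported to this common starting
      point.\<close>
    define z where "z = x(i' := y i')"
    have z: "z \<in> S" unfolding z_def using x y ii' by (intro upd_in PiE_mem[OF y(1)])
    have "?d z (z(i := a)) = ?d x (x(i := a))"
      by (rule rectangle(2)[OF z upd_in[OF z ii'(1) x(2)] x(1) upd_in[OF x(1) ii'(1) x(2)] _ j])
        (use ne in \<open>auto simp: z_def\<close>)
    moreover have "?d z (z(i' := b)) = ?d y (y(i' := b))"
      by (rule rectangle(2)[OF z upd_in[OF z ii'(2) y(2)] y(1) upd_in[OF y(1) ii'(2) y(2)] _ j])
        (simp add: z_def)
    ultimately show False
      using two_active_directions[OF trees \<rho> K j ii' ne z x(2) y(2)] x y by auto
  qed
  \<comment> \<open>This is the active direction if there is one, and otherwise \<open>j\<close> as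
    a default.\<close>
  obtain i where i: "i \<in> {1..N}" and inactive: "\<And>k. k \<in> {1..N} \<Longrightarrow> k \<noteq> i \<Longrightarrow> \<not> active k"
    using uniq j by metis
  have "?d x y \<le> mdist (X i) (x i) (y i) + real N * K" if xy: "x \<in> S" "y \<in> S" for x y
  proof -
    define mix where "mix T = (\<lambda>k. if k \<in> T then y k else x k)" for T
    have mix: "mix T \<in> S" for T using xy by (auto simp: mix_def PiE_iff extensional_def)
    have "?d x (mix (insert i T)) \<le> mdist (X i) (x i) (y i) + real (card T) * K"
      if "finite T" "T \<subseteq> {1..N} - {i}" for T
      using that
    proof (induction T)
      case empty
      have eq: "mix {i} = x(i := y i)" by (auto simp: mix_def)
      have "sum_dist N X x (mix {i}) = mdist (X i) (x i) (y i)"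
        using dist_upd[OF xy(1) i PiE_mem[OF xy(1) i] PiE_mem[OF xy(2) i]] by (simp add: eq)
      then show ?case using coord_le[OF xy(1) mix[of "{i}"] j] by simp
    next
      case (insert k T)
      have eq: "mix (insert i (insert k T)) = (mix (insert i T))(k := y k)" by (auto simp: mix_def)
      have "?d (mix (insert i T)) (mix (insert i (insert k T))) \<le> K"
        unfolding eq using inactive[of k] insert mix PiE_mem[OF xy(2)] unfolding active_def
        by (auto simp: not_less)
      moreover have "?d x (mix (insert i (insert k T))) \<le> ?d x (mix (insert i T)) + ?d (mix (insert i T)) (mix (insert i (insert k T)))"
        using f_coord mix xy j by (intro mdist_triangle) auto
      ultimately show ?case using insert by (simp add: algebra_simps)
    qed
    from this[of "{1..N} - {i}"]
    have "?d x (mix (insert i ({1..N} - {i}))) \<le> mdist (X i) (x i) (y i) + real (card ({1..N} - {i})) * K" by simp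
    moreover have "mix (insert i ({1..N} - {i})) = y"
      using xy i by (auto simp: mix_def PiE_iff extensional_def fun_eq_iff)
    moreover have "real (card ({1..N} - {i})) * K \<le> real N * K"
      using K0 i by (intro mult_right_mono) auto
    ultimately show ?thesis by simp
  qed
  then show ?thesis using i by blast
qed

end

section \<open>Bounded operators on the space of absolutely summable sequences\<close>

definition unit_l1 :: "nat \<Rightarrow> l1" where
  "unit_l1 n = Abs_l1 (\<lambda>k. if k = n then 1 else 0)"

lemma l1_nth_unit: "l1_nth (unit_l1 n) k = (if k = n then 1 else 0)"
proof -
  have "(\<lambda>k. \<bar>if k = n then 1 else 0 :: real\<bar>) sums (\<Sum>k\<in>{n}. \<bar>if k = n then 1 else 0\<bar>)"
    by (rule sums_finite) auto
  then show ?thesis unfolding unit_l1_def by (subst Abs_l1_inverse) (auto dest: sums_summable)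
qed

lemma norm_unit_l1 [simp]: "norm (unit_l1 n) = 1"
proof -
  have "(\<lambda>k. \<bar>l1_nth (unit_l1 n) k\<bar>) sums (\<Sum>k\<in>{n}. \<bar>l1_nth (unit_l1 n) k\<bar>)"
    by (rule sums_finite) (auto simp: l1_nth_unit)
  then show ?thesis unfolding norm_l1_def by (simp add: l1_nth_unit sums_iff)
qed

lemma l1_nth_sum: "l1_nth (sum f I) k = (\<Sum>i\<in>I. l1_nth (f i) k)"
  by (induction I rule: infinite_finite_induct) (auto simp: zero_l1.rep_eq plus_l1.rep_eq)

text \<open>The norm of the remainder after \<open>m\<close> terms is the tail of the series
  defining \<open>norm x\<close>.\<close>

lemma unit_l1_expansion: "(\<lambda>n. l1_nth x n *\<^sub>R unit_l1 n) sums x"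
proof -
  have nth: "l1_nth (x - (\<Sum>n<m. l1_nth x n *\<^sub>R unit_l1 n)) k = (if k < m then 0 else l1_nth x k)" for m k
  proof -
    have "(\<Sum>n<m. l1_nth x n * (if k = n then 1 else 0)) = (\<Sum>n<m. if n = k then l1_nth x n else 0)"
      by (intro sum.cong) auto
    then show ?thesis
      by (simp add: minus_l1.rep_eq l1_nth_sum scaleR_l1.rep_eq l1_nth_unit)
  qed
  have "norm (x - (\<Sum>n<m. l1_nth x n *\<^sub>R unit_l1 n)) = norm x - (\<Sum>n<m. \<bar>l1_nth x n\<bar>)" for m
  proof -
    have "(\<lambda>k. if k \<in> {..<m} then \<bar>l1_nth x k\<bar> else 0) sums (\<Sum>n<m. \<bar>l1_nth x n\<bar>)"
      by (rule sums_If_finite_set) simp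
    from sums_diff[OF summable_sums[OF summable_l1_nth[of x]] this]
    have "(\<lambda>k. \<bar>l1_nth x k\<bar> - (if k \<in> {..<m} then \<bar>l1_nth x k\<bar> else 0)) sums (norm x - (\<Sum>n<m. \<bar>l1_nth x n\<bar>))"
      by (simp add: norm_l1_def)
    moreover have "(\<lambda>k. \<bar>l1_nth x k\<bar> - (if k \<in> {..<m} then \<bar>l1_nth x k\<bar> else 0))
        = (\<lambda>k. \<bar>l1_nth (x - (\<Sum>n<m. l1_nth x n *\<^sub>R unit_l1 n)) k\<bar>)"
      by (auto simp: nth)
    ultimately show ?thesis by (simp add: norm_l1_def sums_iff)
  qed
  moreover have "(\<lambda>m. norm x - (\<Sum>n<m. \<bar>l1_nth x n\<bar>)) \<longlonglongrightarrow> norm x - norm x"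
    unfolding norm_l1_def by (intro tendsto_intros summable_LIMSEQ summable_l1_nth)
  ultimately have "(\<lambda>m. norm (x - (\<Sum>n<m. l1_nth x n *\<^sub>R unit_l1 n))) \<longlonglongrightarrow> 0" by simp
  then have "(\<lambda>m. (\<Sum>n<m. l1_nth x n *\<^sub>R unit_l1 n) - x) \<longlonglongrightarrow> 0"
    by (subst (asm) norm_minus_commute) (rule tendsto_norm_zero_cancel)
  then show ?thesis unfolding sums_def by (simp add: LIM_zero_iff)
qed

lemma blinfun_eqI_unit_l1:
  assumes "\<And>n. blinfun_apply B (unit_l1 n) = blinfun_apply B' (unit_l1 n)"
  shows "B = B'"
proof (rule blinfun_eqI)
  fix x
  have "(\<lambda>n. blinfun_apply B (l1_nth x n *\<^sub>R unit_l1 n)) sums blinfun_apply B x"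
    "(\<lambda>n. blinfun_apply B' (l1_nth x n *\<^sub>R unit_l1 n)) sums blinfun_apply B' x"
    by (intro bounded_linear.sums[OF blinfun.bounded_linear_right] unit_l1_expansion)+
  then show "blinfun_apply B x = blinfun_apply B' x"
    by (simp add: assms blinfun.scaleR_right sums_unique2)
qed

text \<open>The universal property of \<open>l1\<close>: a bounded sequence of images of the unit
  vectors extends with the same bound. Uniform boundedness thus needs checking on basis vectors
  only.\<close>

lemma blinfun_l1_exists:
  fixes T :: "nat \<Rightarrow> 'b::banach"
  assumes M: "\<And>n. norm (T n) \<le> M"
  shows "\<exists>B :: l1 \<Rightarrow>\<^sub>L 'b. (\<forall>n. blinfun_apply B (unit_l1 n) = T n) \<and> norm B \<le> M"
proof -
  have M0: "M \<ge> 0" using M[of 0] norm_ge_zero order_trans by blast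
  define f where "f x = (\<Sum>n. l1_nth x n *\<^sub>R T n)" for x
  have le: "norm (l1_nth x n *\<^sub>R T n) \<le> \<bar>l1_nth x n\<bar> * M" for x n
    using M[of n] by (simp add: mult_left_mono)
  have sm: "summable (\<lambda>n. \<bar>l1_nth x n\<bar> * M)" for x
    by (intro summable_mult2 summable_l1_nth)
  have sn: "summable (\<lambda>n. norm (l1_nth x n *\<^sub>R T n))" for x
    by (rule summable_comparison_test'[OF sm, where N = 0]) (use le in simp)
  have s: "summable (\<lambda>n. l1_nth x n *\<^sub>R T n)" for x
    by (rule summable_norm_cancel[OF sn])
  have nf: "norm (f x) \<le> norm x * M" for x
  proof -
    have "norm (f x) \<le> (\<Sum>n. norm (l1_nth x n *\<^sub>R T n))" unfolding f_def by (rule summable_norm[OF sn])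
    also have "\<dots> \<le> (\<Sum>n. \<bar>l1_nth x n\<bar> * M)" by (rule suminf_le[OF le sn sm])
    also have "\<dots> = norm x * M" unfolding norm_l1_def by (rule suminf_mult2[symmetric, OF summable_l1_nth])
    finally show ?thesis .
  qed
  have bl: "bounded_linear f"
  proof (rule bounded_linear_intro[where K = M])
    show "f (x + y) = f x + f y" for x y
      unfolding f_def by (simp add: plus_l1.rep_eq scaleR_add_left suminf_add[OF s s])
    show "f (c *\<^sub>R x) = c *\<^sub>R f x" for c x
      unfolding f_def by (simp add: scaleR_l1.rep_eq suminf_scaleR_right[OF s] flip: scaleR_scaleR)
  qed (rule nf)
  have "f (unit_l1 n) = T n" for n
  proof -
    have "(\<lambda>k. l1_nth (unit_l1 n) k *\<^sub>R T k) sums (\<Sum>k\<in>{n}. l1_nth (unit_l1 n) k *\<^sub>R T k)"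
      by (rule sums_finite) (auto simp: l1_nth_unit)
    then show ?thesis unfolding f_def by (simp add: l1_nth_unit sums_iff)
  qed
  moreover have "norm (Blinfun f) \<le> M"
    by (rule norm_blinfun_bound[OF M0]) (simp add: bounded_linear_Blinfun_apply[OF bl] nf mult.commute[of M])
  ultimately show ?thesis
    by (intro exI[of _ "Blinfun f"]) (simp add: bounded_linear_Blinfun_apply[OF bl])
qed

text \<open>A functional dominated by the norm that counts the terms of a sum of unit vectors; it
  yields lower bounds for norms.\<close>

definition coord_sum :: "l1 \<Rightarrow> real" where
  "coord_sum x = (\<Sum>n. l1_nth x n)"

lemma summable_l1_nth': "summable (l1_nth x)"
  using summable_rabs_cancel[OF summable_l1_nth] .

lemma linear_coord_sum: "linear coord_sum"
  by (rule linearI)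
    (simp_all add: coord_sum_def plus_l1.rep_eq scaleR_l1.rep_eq suminf_add suminf_mult summable_l1_nth')

lemma coord_sum_unit [simp]: "coord_sum (unit_l1 n) = 1"
proof -
  have "l1_nth (unit_l1 n) sums (\<Sum>k\<in>{n}. l1_nth (unit_l1 n) k)"
    by (rule sums_finite) (auto simp: l1_nth_unit)
  then show ?thesis unfolding coord_sum_def by (simp add: l1_nth_unit sums_iff)
qed

lemma coord_sum_le_norm: "coord_sum x \<le> norm x"
  unfolding coord_sum_def norm_l1_def
  by (rule suminf_le) (auto simp: summable_l1_nth' summable_l1_nth)

lemma norm_sum_unit_le: "norm (\<Sum>z\<in>I. unit_l1 (h z)) \<le> card I"
  using norm_sum[of "\<lambda>z. unit_l1 (h z)" I] by simp

lemma norm_sum_unit_diff_le: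
  assumes "finite I" "finite J"
  shows "norm ((\<Sum>z\<in>I. unit_l1 (h z)) - (\<Sum>z\<in>J. unit_l1 (h z))) \<le> card (I - J) + card (J - I)"
proof -
  have "(\<Sum>z\<in>I. unit_l1 (h z)) = (\<Sum>z\<in>I - J. unit_l1 (h z)) + (\<Sum>z\<in>I \<inter> J. unit_l1 (h z))"
    "(\<Sum>z\<in>J. unit_l1 (h z)) = (\<Sum>z\<in>J - I. unit_l1 (h z)) + (\<Sum>z\<in>I \<inter> J. unit_l1 (h z))"
    using assms sum.Int_Diff[of I "\<lambda>z. unit_l1 (h z)" J] sum.Int_Diff[of J "\<lambda>z. unit_l1 (h z)" I]
    by (simp_all add: Int_commute add.commute)
  then have "(\<Sum>z\<in>I. unit_l1 (h z)) - (\<Sum>z\<in>J. unit_l1 (h z))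
      = (\<Sum>z\<in>I - J. unit_l1 (h z)) - (\<Sum>z\<in>J - I. unit_l1 (h z))" by simp
  then show ?thesis
    using norm_triangle_ineq4[of "\<Sum>z\<in>I - J. unit_l1 (h z)" "\<Sum>z\<in>J - I. unit_l1 (h z)"]
      norm_sum_unit_le[of h "I - J"] norm_sum_unit_le[of h "J - I"] by simp
qed

section \<open>The representation\<close>

lemma countable_closure:
  assumes F: "countable F" and q: "q \<in> S" and S: "\<And>f y. f \<in> F \<Longrightarrow> y \<in> S \<Longrightarrow> f y \<in> S"
  obtains Y where "countable Y" "q \<in> Y" "Y \<subseteq> S" "\<And>f y. f \<in> F \<Longrightarrow> y \<in> Y \<Longrightarrow> f y \<in> Y"
proof
  let ?Y = "(\<lambda>fs. foldr id fs q) ` lists F"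
  show "countable ?Y" using F by simp
  show "q \<in> ?Y" by (rule image_eqI[of _ _ "[]"]) auto
  have "foldr id fs q \<in> S" if "fs \<in> lists F" for fs
    using that by (induction fs) (auto simp: q S)
  then show "?Y \<subseteq> S" by auto
  show "f y \<in> ?Y" if "f \<in> F" "y \<in> ?Y" for f y
  proof -
    obtain fs where "fs \<in> lists F" "y = foldr id fs q" using \<open>y \<in> ?Y\<close> by auto
    then show ?thesis using \<open>f \<in> F\<close> by (intro image_eqI[of _ _ "f # fs"]) auto
  qed
qed

text \<open>Left translations by generators and their inverses preserve a countable set containing
  \<one>. Then so does every element \<open>h\<close> of the generated group, and \<open>h\<close>
  is the translate of \<one>.\<close>

lemma (in group) countable_generate:
  assumes H: "countable H" "H \<subseteq> carrier G"
  shows "countable (generate G H)"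
proof -
  let ?F = "(\<lambda>h x. h \<otimes> x) ` (H \<union> m_inv G ` H)"
  obtain Y where Y: "countable Y" "\<one> \<in> Y" "Y \<subseteq> carrier G" "\<And>f y. f \<in> ?F \<Longrightarrow> y \<in> Y \<Longrightarrow> f y \<in> Y"
  proof (rule countable_closure[of ?F "\<one>" "carrier G"])
    show "countable ?F" using H by simp
  qed (use H in auto)
  have "h \<otimes> y \<in> Y" if "h \<in> generate G H" "y \<in> Y" for h y
    using that
  proof (induction arbitrary: y rule: generate.induct)
    case one
    then show ?case using Y(3) by auto
  next
    case (incl h)
    then show ?case using Y(4)[of "\<lambda>x. h \<otimes> x" y] by blast
  next
    case (inv h)
    then show ?case using Y(4)[of "\<lambda>x. inv h \<otimes> x" y] by blast
  next
    case (eng h1 h2)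
    then show ?case using Y(3) generate_in_carrier[OF H(2)] m_assoc[of h1 h2 y] by auto
  qed
  from this[OF _ Y(2)] have "generate G H \<subseteq> Y"
    using generate_in_carrier[OF H(2)] by auto
  then show ?thesis using Y(1) countable_subset by blast
qed

text \<open>\<open>Y\<close> indexes the basis vectors in use. Its closure properties ensure that it
  contains every point occurring in the change of basis between edges and point masses.\<close>

locale tree_product =
  fixes N :: nat and X :: "nat \<Rightarrow> 'a metric" and q :: "nat \<Rightarrow> 'a"
    and par :: "nat \<Rightarrow> 'a \<Rightarrow> 'a" and A :: "nat \<Rightarrow> 'a \<Rightarrow> 'a set" and r L :: "nat \<Rightarrow> real"
    and \<rho> \<Lambda> :: real and Y :: "(nat \<Rightarrow> 'a) set"
  assumes trees: "i \<in> {1..N} \<Longrightarrow> coarse_tree (X i) (q i) (par i) (A i) (r i) (L i)"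
    and r_le: "i \<in> {1..N} \<Longrightarrow> r i \<le> \<rho>" and L_le: "i \<in> {1..N} \<Longrightarrow> L i \<le> \<Lambda>"
    and \<rho>_nonneg: "0 \<le> \<rho>" and \<Lambda>_nonneg: "0 \<le> \<Lambda>"
    and q_in: "q \<in> (\<Pi>\<^sub>E i\<in>{1..N}. mspace (X i))"
    and countable_Y: "countable Y" and Y_subset: "Y \<subseteq> (\<Pi>\<^sub>E i\<in>{1..N}. mspace (X i))"
    and q_in_Y: "q \<in> Y"
    and Y_axis: "y \<in> Y \<Longrightarrow> i \<in> {1..N} \<Longrightarrow> q(i := y i) \<in> Y"
    and Y_par: "y \<in> Y \<Longrightarrow> i \<in> {1..N} \<Longrightarrow> y i \<noteq> q i \<Longrightarrow> q(i := par i (y i)) \<in> Y"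
begin

abbreviation "S \<equiv> \<Pi>\<^sub>E i\<in>{1..N}. mspace (X i)"

definition e :: "(nat \<Rightarrow> 'a) \<Rightarrow> l1" where
  "e y = unit_l1 (to_nat_on Y y)"

text \<open>The vector \<open>\<beta> y\<close> represents \<open>\<delta>(y) - \<delta>(q)\<close>, and the basis vector \<open>e y\<close> represents
  \<open>\<delta>(y) - \<delta>(up y)\<close> if \<open>y\<close> differs from \<open>q\<close> in exactly one coordinate. For the remaining \<open>y\<close> it
  represents a combination of point masses with vanishing projections to all factors.\<close>

definition axis :: "(nat \<Rightarrow> 'a) \<Rightarrow> bool" where
  "axis y \<longleftrightarrow> (\<exists>i\<in>{1..N}. y i \<noteq> q i \<and> y = q(i := y i))"

definition dir :: "(nat \<Rightarrow> 'a) \<Rightarrow> nat" where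
  "dir y = (SOME i. y i \<noteq> q i)"

definition up :: "(nat \<Rightarrow> 'a) \<Rightarrow> nat \<Rightarrow> 'a" where
  "up y = q(dir y := par (dir y) (y (dir y)))"

definition \<beta>c :: "nat \<Rightarrow> (nat \<Rightarrow> 'a) \<Rightarrow> l1" where
  "\<beta>c i y = (\<Sum>z\<in>A i (y i). e (q(i := z)))"

definition \<beta> :: "(nat \<Rightarrow> 'a) \<Rightarrow> l1" where
  "\<beta> y = (\<Sum>i=1..N. \<beta>c i y) + (if y = q \<or> axis y then 0 else e y)"

text \<open>The vector \<open>e y\<close> is the combination of values of \<open>\<beta>\<close> obtained by taking \<open>\<gamma> = \<beta>\<close> here.
  Replacing \<open>\<beta>\<close> by its translate under a group element yields the image of \<open>e y\<close>.\<close>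

definition \<Delta> :: "((nat \<Rightarrow> 'a) \<Rightarrow> l1) \<Rightarrow> (nat \<Rightarrow> 'a) \<Rightarrow> l1" where
  "\<Delta> \<gamma> y = (if axis y then \<gamma> y - \<gamma> (up y) else \<gamma> y - (\<Sum>i=1..N. \<gamma> (q(i := y i))))"

section \<open>Change of basis between point masses and edges\<close>

lemma coord: "y \<in> S \<Longrightarrow> i \<in> {1..N} \<Longrightarrow> y i \<in> mspace (X i)"
  by (rule PiE_mem)

lemma upd_in: "i \<in> {1..N} \<Longrightarrow> x \<in> mspace (X i) \<Longrightarrow> q(i := x) \<in> S"
  using q_in by (auto simp: PiE_iff extensional_def)

lemma finite_A: "y \<in> S \<Longrightarrow> i \<in> {1..N} \<Longrightarrow> finite (A i (y i))"
  using coarse_tree.finite_A[OF trees] coord by blast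

lemma A_base: "i \<in> {1..N} \<Longrightarrow> A i (q i) = {}"
  using coarse_tree.A_base[OF trees] .

lemma axis_upd: "i \<in> {1..N} \<Longrightarrow> x \<noteq> q i \<Longrightarrow> axis (q(i := x))"
  unfolding axis_def by (intro bexI[of _ i]) auto

lemma up_upd: "x \<noteq> q i \<Longrightarrow> up (q(i := x)) = q(i := par i x)"
proof -
  assume x: "x \<noteq> q i"
  have "dir (q(i := x)) = i"
    unfolding dir_def by (rule some_equality) (use x in \<open>auto split: if_splits\<close>)
  then show ?thesis by (simp add: up_def)
qed

lemma axisE:
  assumes "axis y"
  obtains i where "i \<in> {1..N}" "y i \<noteq> q i" "y = q(i := y i)" "up y = q(i := par i (y i))"
  using assms up_upd unfolding axis_def by metis

lemma \<Delta>_axis: "i \<in> {1..N} \<Longrightarrow> x \<noteq> q i \<Longrightarrow> \<Delta> \<gamma> (q(i := x)) = \<gamma> (q(i := x)) - \<gamma> (q(i := par i x))"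
  by (simp add: \<Delta>_def axis_upd up_upd)

lemma \<Delta>_telescope:
  assumes "\<gamma> q = 0" "i \<in> {1..N}" "x \<in> mspace (X i)"
  shows "(\<Sum>z\<in>A i x. \<Delta> \<gamma> (q(i := z))) = \<gamma> (q(i := x))"
proof -
  interpret coarse_tree "X i" "q i" "par i" "A i" "r i" "L i" using trees assms(2) .
  show ?thesis
    using assms(3)
  proof (induction rule: par_induct)
    case base
    then show ?case using assms by (simp add: A_base)
  next
    case (par x)
    then show ?case using assms(2) notin_A_par[of x] finite_A[of "par i x"] by (simp add: A_par \<Delta>_axis del: fun_upd_apply)
  qed
qed

text \<open>By telescoping, \<gamma> is recovered from \<open>\<Delta> \<gamma>\<close> by the same
  formula that builds \<beta> from \<open>e\<close>. The vanishing at \<open>q\<close> removes the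
  contribution of the root.\<close>

lemma expansion:
  assumes "\<gamma> q = 0" "y \<in> S"
  shows "\<gamma> y = (\<Sum>i=1..N. \<Sum>z\<in>A i (y i). \<Delta> \<gamma> (q(i := z))) + (if y = q \<or> axis y then 0 else \<Delta> \<gamma> y)"
proof -
  have *: "(\<Sum>i=1..N. \<Sum>z\<in>A i (y i). \<Delta> \<gamma> (q(i := z))) = (\<Sum>i=1..N. \<gamma> (q(i := y i)))"
    using assms by (intro sum.cong refl \<Delta>_telescope coord) auto
  show ?thesis
  proof (cases "axis y")
    case True
    then obtain k where k: "k \<in> {1..N}" "y k \<noteq> q k" "y = q(k := y k)" by (rule axisE)
    have "\<gamma> (q(i := y i)) = (if i = k then \<gamma> y else 0)" for i
    proof (cases "i = k")
      case False
      then have "y i = q i" by (subst k(3)) simp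
      then show ?thesis using False assms(1) by simp
    qed (use k in simp)
    then show ?thesis unfolding * using True k(1) by simp
  next
    case False
    then show ?thesis unfolding * using assms(1) by (cases "y = q") (auto simp: \<Delta>_def)
  qed
qed

lemma \<beta>_upd:
  assumes "i \<in> {1..N}" "x \<in> mspace (X i)"
  shows "\<beta> (q(i := x)) = (\<Sum>z\<in>A i x. e (q(i := z)))"
proof -
  have "\<beta>c k (q(i := x)) = (if k = i then \<Sum>z\<in>A i x. e (q(i := z)) else 0)" if "k \<in> {1..N}" for k
    using A_base[OF that] by (simp add: \<beta>c_def)
  then have "(\<Sum>k=1..N. \<beta>c k (q(i := x))) = (\<Sum>z\<in>A i x. e (q(i := z)))"
    using assms(1) by simp
  moreover have "q(i := x) = q \<or> axis (q(i := x))" using axis_upd assms(1) by (cases "x = q i") auto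
  ultimately show ?thesis by (simp add: \<beta>_def)
qed

lemma \<beta>_base: "\<beta> q = 0"
  by (simp add: \<beta>_def \<beta>c_def A_base)

text \<open>The opposite change of basis to \<open>expansion\<close>: the basis vectors are
  recovered from the values of \<beta>.\<close>

lemma \<Delta>_\<beta>:
  assumes "y \<in> S" "y \<noteq> q"
  shows "\<Delta> \<beta> y = e y"
proof (cases "axis y")
  case True
  then obtain i where i: "i \<in> {1..N}" "y i \<noteq> q i" "y = q(i := y i)" by (rule axisE)
  interpret coarse_tree "X i" "q i" "par i" "A i" "r i" "L i" using trees i(1) .
  let ?x = "y i"
  have x: "?x \<in> mspace (X i)" using assms i coord by blast
  have "\<Delta> \<beta> (q(i := ?x)) = e (q(i := ?x))"
    using x i(1,2) par_in[OF x i(2)] notin_A_par[OF x i(2)] finite_A[of "par i ?x"]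
    by (simp add: \<Delta>_axis \<beta>_upd A_par)
  then show ?thesis using i(3) by simp
next
  case False
  have "(\<Sum>i=1..N. \<beta> (q(i := y i))) = (\<Sum>i=1..N. \<beta>c i y)"
    using assms by (intro sum.cong refl) (simp add: \<beta>_upd coord \<beta>c_def)
  then show ?thesis using False assms by (simp add: \<Delta>_def \<beta>_def)
qed

lemma \<Delta>_linear: "linear B \<Longrightarrow> B (\<Delta> \<gamma> y) = \<Delta> (\<lambda>x. B (\<gamma> x)) y"
  by (simp add: \<Delta>_def linear_diff linear_sum)

lemma up_in_Y: "y \<in> Y \<Longrightarrow> axis y \<Longrightarrow> up y \<in> Y"
  by (metis axisE Y_par)

lemma \<Delta>_cong: "y \<in> Y \<Longrightarrow> (\<And>x. x \<in> Y \<Longrightarrow> \<gamma> x = \<gamma>' x) \<Longrightarrow> \<Delta> \<gamma> y = \<Delta> \<gamma>' y"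
  by (simp add: \<Delta>_def up_in_Y Y_axis)

lemma ancestor_in_Y:
  assumes "y \<in> Y" "i \<in> {1..N}" "z \<in> A i (y i)"
  shows "q(i := z) \<in> Y - {q}"
proof -
  interpret coarse_tree "X i" "q i" "par i" "A i" "r i" "L i" using trees assms(2) .
  have "q(i := x) \<in> Y \<Longrightarrow> z \<in> A i x \<Longrightarrow> q(i := z) \<in> Y" if "x \<in> mspace (X i)" for x
    using that
  proof (induction rule: par_induct)
    case base
    then show ?case using A_base by simp
  next
    case (par x)
    show ?case
    proof (cases "z = x")
      case False
      then have "z \<in> A i (par i x)" using A_par[of x] par by simp
      moreover have "q(i := par i x) \<in> Y" using Y_par[OF par.prems(1) assms(2)] par by simp
      ultimately show ?thesis using par.IH by blast
    qed (use par in simp)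
  qed
  moreover have y: "y i \<in> mspace (X i)" using assms coord Y_subset by blast
  ultimately have "q(i := z) \<in> Y" using Y_axis assms by blast
  moreover have "z \<noteq> q i" using A_subset[OF y] assms by auto
  ultimately show ?thesis by (metis Diff_iff fun_upd_same singletonD)
qed

text \<open>Indices that belong to no point of \<open>Y - {q}\<close>, including the index of
  \<open>q\<close>, are fixed, so that composition of operators behaves well on them too.\<close>

lemma operator_exists:
  assumes "\<And>y. y \<in> Y - {q} \<Longrightarrow> norm (\<Delta> \<gamma> y) \<le> M" "1 \<le> M"
  shows "\<exists>B :: l1 \<Rightarrow>\<^sub>L l1. (\<forall>y\<in>Y - {q}. blinfun_apply B (e y) = \<Delta> \<gamma> y) \<and>
    (\<forall>n. n \<notin> to_nat_on Y ` (Y - {q}) \<longrightarrow> blinfun_apply B (unit_l1 n) = unit_l1 n) \<and> norm B \<le> M"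
proof -
  have inj: "inj_on (to_nat_on Y) (Y - {q})"
    using inj_on_to_nat_on[OF countable_Y] by (rule inj_on_subset) auto
  define T where "T n = (if n \<in> to_nat_on Y ` (Y - {q}) then \<Delta> \<gamma> (inv_into (Y - {q}) (to_nat_on Y) n) else unit_l1 n)" for n
  have "norm (T n) \<le> M" for n
    using assms inv_into_into[of n "to_nat_on Y" "Y - {q}"] by (simp add: T_def)
  from blinfun_l1_exists[of T, OF this]
  obtain B :: "l1 \<Rightarrow>\<^sub>L l1" where B: "\<And>n. blinfun_apply B (unit_l1 n) = T n" "norm B \<le> M" by blast
  have "blinfun_apply B (e y) = \<Delta> \<gamma> y" if "y \<in> Y - {q}" for y
    unfolding e_def B T_def using that inj by (simp add: inv_into_f_f)
  then show ?thesis using B by (intro exI[of _ B]) (auto simp: T_def)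
qed

lemma operator_\<beta>:
  assumes B: "\<And>y. y \<in> Y - {q} \<Longrightarrow> blinfun_apply B (e y) = \<Delta> \<gamma> y" and "\<gamma> q = 0" "y \<in> Y"
  shows "blinfun_apply B (\<beta> y) = \<gamma> y"
proof -
  have "blinfun_apply B (\<beta> y) =
      (\<Sum>i=1..N. \<Sum>z\<in>A i (y i). blinfun_apply B (e (q(i := z)))) + (if y = q \<or> axis y then 0 else blinfun_apply B (e y))"
    by (simp add: \<beta>_def \<beta>c_def blinfun.add_right blinfun.sum_right)
  also have "\<dots> = (\<Sum>i=1..N. \<Sum>z\<in>A i (y i). \<Delta> \<gamma> (q(i := z))) + (if y = q \<or> axis y then 0 else \<Delta> \<gamma> y)"
    using B ancestor_in_Y assms by (intro arg_cong2[where f = plus] sum.cong refl) auto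
  also have "\<dots> = \<gamma> y"
    using expansion[of \<gamma> y] assms Y_subset by auto
  finally show ?thesis .
qed

text \<open>The coefficients of \<open>\<beta> y\<close> are nonnegative, so nothing cancels and
  \<open>coord_sum\<close> counts at least all ancestors in all coordinates, each worth a step of
  length at most \<rho>.\<close>

lemma dist_le_norm_\<beta>:
  assumes "y \<in> S"
  shows "sum_dist N X y q \<le> \<rho> * norm (\<beta> y)"
proof -
  have "sum_dist N X y q \<le> (\<Sum>i=1..N. \<rho> * card (A i (y i)))"
    unfolding sum_dist_def
  proof (rule sum_mono)
    fix i assume i: "i \<in> {1..N}"
    interpret coarse_tree "X i" "q i" "par i" "A i" "r i" "L i" using trees i .
    have "mdist (X i) (y i) (q i) \<le> r i * card (A i (y i))" using dist_base_le coord assms i by blast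
    also have "\<dots> \<le> \<rho> * card (A i (y i))" using r_le[OF i] by (intro mult_right_mono) auto
    finally show "mdist (X i) (y i) (q i) \<le> \<rho> * card (A i (y i))" .
  qed
  also have "\<dots> = \<rho> * (\<Sum>i=1..N. real (card (A i (y i))))" by (simp add: sum_distrib_left)
  also have "\<dots> \<le> \<rho> * coord_sum (\<beta> y)"
  proof (rule mult_left_mono[OF _ \<rho>_nonneg])
    note lin = linear_coord_sum
    have "coord_sum (\<beta> y) = (\<Sum>i=1..N. \<Sum>z\<in>A i (y i). 1) + coord_sum (if y = q \<or> axis y then 0 else e y)"
      unfolding \<beta>_def \<beta>c_def by (simp add: linear_add[OF lin] linear_sum[OF lin] e_def)
    moreover have "coord_sum (if y = q \<or> axis y then 0 else e y) \<ge> 0"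
      by (simp add: linear_0[OF lin] e_def)
    ultimately show "(\<Sum>i=1..N. real (card (A i (y i)))) \<le> coord_sum (\<beta> y)" by simp
  qed
  also have "\<dots> \<le> \<rho> * norm (\<beta> y)" using coord_sum_le_norm \<rho>_nonneg by (intro mult_left_mono)
  finally show ?thesis .
qed

lemma norm_\<beta>c_diff_le:
  assumes "x \<in> S" "y \<in> S" "i \<in> {1..N}" "mdist (X i) (x i) (y i) \<le> \<delta>"
  shows "norm (\<beta>c i x - \<beta>c i y) \<le> 2 * (\<Lambda> * \<delta> + \<Lambda>)"
proof -
  interpret coarse_tree "X i" "q i" "par i" "A i" "r i" "L i" using trees assms(3) .
  have c: "x i \<in> mspace (X i)" "y i \<in> mspace (X i)" using assms coord by auto
  have "0 \<le> \<delta>" using assms(4) mdist_nonneg[of "X i" "x i" "y i"] by linarith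
  then have "L i * mdist (X i) (x i) (y i) \<le> \<Lambda> * \<delta>"
    using L_le[OF assms(3)] assms(4) \<Lambda>_nonneg by (intro mult_mono) auto
  then have "L i * mdist (X i) (x i) (y i) + L i \<le> \<Lambda> * \<delta> + \<Lambda>" using L_le[OF assms(3)] by simp
  then have "real (card (A i (x i) - A i (y i))) \<le> \<Lambda> * \<delta> + \<Lambda>" "real (card (A i (y i) - A i (x i))) \<le> \<Lambda> * \<delta> + \<Lambda>"
    using card_A_diff[OF c] card_A_diff[OF c(2,1)] by (simp_all add: mdist_commute[of _ "y i"])
  moreover have "norm (\<beta>c i x - \<beta>c i y) \<le> real (card (A i (x i) - A i (y i))) + card (A i (y i) - A i (x i))"
    unfolding \<beta>c_def e_def using norm_sum_unit_diff_le[of "A i (x i)" "A i (y i)" "\<lambda>z. to_nat_on Y (q(i := z))"] finite_A[OF c(1)] finite_A[OF c(2)] by simp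
  ultimately show ?thesis unfolding mult_2 by (meson add_mono order_trans)
qed

lemma norm_\<beta>_rest: "norm (if y = q \<or> axis y then 0 else e y) \<le> 1"
  by (simp add: e_def)

lemma norm_\<beta>_diff_le:
  assumes "x \<in> S" "y \<in> S"
  shows "norm (\<beta> x - \<beta> y) \<le> 2 * \<Lambda> * sum_dist N X x y + 2 * \<Lambda> * N + 2"
proof -
  let ?u = "\<lambda>y. if y = q \<or> axis y then 0 else e y"
  have "\<beta> x - \<beta> y = (\<Sum>i=1..N. \<beta>c i x - \<beta>c i y) + (?u x - ?u y)"
    unfolding \<beta>_def sum_subtractf by (rule add_diff_add)
  then have "norm (\<beta> x - \<beta> y) \<le> norm (\<Sum>i=1..N. \<beta>c i x - \<beta>c i y) + norm (?u x - ?u y)"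
    by (simp only: norm_triangle_ineq)
  also have "norm (?u x - ?u y) \<le> 2"
    using norm_triangle_ineq4[of "?u x" "?u y"] norm_\<beta>_rest[of x] norm_\<beta>_rest[of y] by linarith
  also have "norm (\<Sum>i=1..N. \<beta>c i x - \<beta>c i y) \<le> (\<Sum>i=1..N. 2 * (\<Lambda> * mdist (X i) (x i) (y i) + \<Lambda>))"
    by (intro sum_norm_le norm_\<beta>c_diff_le assms) auto
  also have "\<dots> = 2 * \<Lambda> * sum_dist N X x y + 2 * \<Lambda> * N"
    by (simp add: sum_dist_def sum.distrib sum_distrib_left algebra_simps)
  finally show ?thesis by simp
qed

text \<open>The first group of terms bounds the image of an edge, whose ends are within \<rho>. The
  second bounds the image of any other basis vector: \<open>N\<close> errors in each of
  \<open>N\<close> coordinates, and remainders of norm at most 2 at \<open>y\<close> and its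
  \<open>N\<close> single-coordinate versions.\<close>

lemma norm_\<Delta>_le:
  assumes "product_isometry N X f"
    and one: "\<And>j. j \<in> {1..N} \<Longrightarrow> \<exists>i\<in>{1..N}. \<forall>x\<in>S. \<forall>y\<in>S. mdist (X j) (f x j) (f y j) \<le> mdist (X i) (x i) (y i) + D"
    and y: "y \<in> S" "y \<noteq> q" and D: "0 \<le> D"
  shows "norm (\<Delta> (\<lambda>x. \<beta> (f x) - \<beta> (f q)) y)
    \<le> 2 * \<Lambda> * \<rho> + 2 * \<Lambda> * N + 2 + (N * (N * (2 * (\<Lambda> * D + \<Lambda>))) + 2 * (N + 1))"
proof -
  interpret f: product_isometry N X f by fact
  have nonneg: "0 \<le> 2 * \<Lambda> * \<rho> + 2 * \<Lambda> * N + 2" "0 \<le> N * (N * (2 * (\<Lambda> * D + \<Lambda>))) + 2 * (real N + 1)"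
    using \<Lambda>_nonneg \<rho>_nonneg D by auto
  show ?thesis
  proof (cases "axis y")
    case True
    then obtain i where i: "i \<in> {1..N}" "y i \<noteq> q i" "y = q(i := y i)" "up y = q(i := par i (y i))"
      by (rule axisE)
    interpret coarse_tree "X i" "q i" "par i" "A i" "r i" "L i" using trees i(1) .
    have p: "par i (y i) \<in> mspace (X i)" "mdist (X i) (y i) (par i (y i)) \<le> \<rho>"
      using par_in par_dist[of "y i"] r_le[OF i(1)] coord[OF y(1) i(1)] i by fastforce+
    have "sum_dist N X y (up y) = mdist (X i) (y i) (par i (y i))"
      using f.dist_upd[OF q_in i(1) coord[OF y(1) i(1)] p(1)] i by simp
    then have "sum_dist N X (f y) (f (up y)) \<le> \<rho>"
      using f.f_isometric[OF y(1), of "up y"] upd_in[OF i(1) p(1)] i(4) p(2) by simp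
    then have "2 * \<Lambda> * sum_dist N X (f y) (f (up y)) \<le> 2 * \<Lambda> * \<rho>"
      using \<Lambda>_nonneg by (intro mult_left_mono) auto
    moreover have "norm (\<beta> (f y) - \<beta> (f (up y))) \<le> 2 * \<Lambda> * sum_dist N X (f y) (f (up y)) + 2 * \<Lambda> * N + 2"
      using f.f_in y upd_in[OF i(1) p(1)] i(4) by (intro norm_\<beta>_diff_le) auto
    ultimately show ?thesis using True nonneg by (simp add: \<Delta>_def)
  next
    case False
    let ?u = "\<lambda>y. if y = q \<or> axis y then 0 else e y"
    let ?\<kappa> = "2 * (\<Lambda> * D + \<Lambda>)"
    define g where "g j x = \<beta>c j (f x) - \<beta>c j (f q)" for j x
    define w where "w x = ?u (f x) - ?u (f q)" for x
    have \<gamma>: "\<beta> (f x) - \<beta> (f q) = (\<Sum>j=1..N. g j x) + w x" for x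
      unfolding \<beta>_def g_def w_def sum_subtractf by (rule add_diff_add)
    have w: "norm (w x) \<le> 2" for x
      using norm_triangle_ineq4[of "?u (f x)" "?u (f q)"] norm_\<beta>_rest[of "f x"] norm_\<beta>_rest[of "f q"]
      unfolding w_def by linarith
    have ax: "q(i := y i) \<in> S" if "i \<in> {1..N}" for i using upd_in coord y that by blast
    have gj: "norm (g j y - (\<Sum>i=1..N. g j (q(i := y i)))) \<le> N * ?\<kappa>" if j: "j \<in> {1..N}" for j
    proof -
      obtain k where k: "k \<in> {1..N}"
        and kd: "\<And>x y. x \<in> S \<Longrightarrow> y \<in> S \<Longrightarrow> mdist (X j) (f x j) (f y j) \<le> mdist (X k) (x k) (y k) + D"
        using one[OF j] by blast
      have near: "norm (\<beta>c j (f x) - \<beta>c j (f x')) \<le> ?\<kappa>" if "x \<in> S" "x' \<in> S" "x k = x' k" for x x'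
        using kd[OF that(1,2)] that f.f_in coord[OF that(2) k] j by (intro norm_\<beta>c_diff_le) auto
      \<comment> \<open>Only the version keeping coordinate \<open>k\<close> is paired with
        \<open>y\<close>; the others agree with \<open>q\<close> in coordinate \<open>k\<close>, so
        each is small by itself.\<close>
      have "g j y - (\<Sum>i=1..N. g j (q(i := y i)))
          = (\<beta>c j (f y) - \<beta>c j (f (q(k := y k)))) - (\<Sum>i\<in>{1..N}-{k}. g j (q(i := y i)))"
        using k by (subst sum.remove[of _ k]) (auto simp: g_def)
      also have "norm \<dots> \<le> ?\<kappa> + (\<Sum>i\<in>{1..N}-{k}. ?\<kappa>)"
      proof (rule order_trans[OF norm_triangle_ineq4 add_mono])
        show "norm (\<beta>c j (f y) - \<beta>c j (f (q(k := y k)))) \<le> ?\<kappa>"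
          using y ax k by (intro near) auto
        have "norm (g j (q(i := y i))) \<le> ?\<kappa>" if "i \<in> {1..N} - {k}" for i
          unfolding g_def using that q_in ax by (intro near) auto
        then show "norm (\<Sum>i\<in>{1..N}-{k}. g j (q(i := y i))) \<le> (\<Sum>i\<in>{1..N}-{k}. ?\<kappa>)"
          by (rule sum_norm_le)
      qed
      also have "\<dots> = (\<Sum>i\<in>{1..N}. ?\<kappa>)" using k by (subst sum.remove[of "{1..N}" k]) auto
      also have "\<dots> = N * ?\<kappa>" by simp
      finally show ?thesis .
    qed
    have "\<Delta> (\<lambda>x. \<beta> (f x) - \<beta> (f q)) y
        = (\<Sum>j=1..N. g j y - (\<Sum>i=1..N. g j (q(i := y i)))) + (w y - (\<Sum>i=1..N. w (q(i := y i))))"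
      unfolding \<Delta>_def \<gamma> using False
      by (simp add: sum.distrib sum_subtractf sum.swap[of "\<lambda>j i. g j (q(i := y i))"])
    also have "norm \<dots> \<le> (\<Sum>j=1..N. N * ?\<kappa>) + (2 + (\<Sum>i=1..N. 2))"
    proof (rule order_trans[OF norm_triangle_ineq add_mono])
      show "norm (\<Sum>j=1..N. g j y - (\<Sum>i=1..N. g j (q(i := y i)))) \<le> (\<Sum>j=1..N. N * ?\<kappa>)"
        by (intro sum_norm_le gj)
      show "norm (w y - (\<Sum>i=1..N. w (q(i := y i)))) \<le> 2 + (\<Sum>i=1..N. 2)"
        by (rule order_trans[OF norm_triangle_ineq4 add_mono[OF w sum_norm_le[OF w]]])
    qed
    also have "\<dots> = N * (N * ?\<kappa>) + 2 * (N + 1)" by simp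
    finally show ?thesis using nonneg by linarith
  qed
qed

end

text \<open>Invertibility is automatic: the image of \<open>inv s\<close> is a two-sided
  inverse.\<close>

lemma homI_GL:
  fixes G (structure)
  assumes "group G"
    and mult: "\<And>s t. s \<in> carrier G \<Longrightarrow> t \<in> carrier G \<Longrightarrow> \<pi> (s \<otimes>\<^bsub>G\<^esub> t) = \<pi> s o\<^sub>L \<pi> t"
    and one: "\<pi> \<one>\<^bsub>G\<^esub> = id_blinfun"
  shows "\<pi> \<in> hom G GL"
proof (rule homI)
  interpret group G by fact
  fix s assume s: "s \<in> carrier G"
  have "\<pi> (inv s) o\<^sub>L \<pi> s = id_blinfun" "\<pi> s o\<^sub>L \<pi> (inv s) = id_blinfun"
    using s mult[of "inv s" s] mult[of s "inv s"] one by simp_all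
  then show "\<pi> s \<in> carrier GL"
    by (auto simp: GL_def units_of_carrier Units_def bounded_operators_def)
  show "\<pi> (s \<otimes> t) = \<pi> s \<otimes>\<^bsub>GL\<^esub> \<pi> t" if "t \<in> carrier G" for t
    using mult s that by (simp add: GL_def units_of_mult bounded_operators_def)
qed

section \<open>The affine action on the sequence space\<close>

context tree_product
begin

lemma affine_action_exists:
  fixes G :: "('g, 'm) monoid_scheme" (structure)
  assumes "group G" and act: "isometric_action G (sum_product N X) \<phi>"
    and Y_act: "\<And>s y. s \<in> carrier G \<Longrightarrow> y \<in> Y \<Longrightarrow> \<phi> s y \<in> Y"
    and one: "\<And>s j. s \<in> carrier G \<Longrightarrow> j \<in> {1..N} \<Longrightarrow>
      \<exists>i\<in>{1..N}. \<forall>x\<in>S. \<forall>y\<in>S. mdist (X j) (\<phi> s x j) (\<phi> s y j) \<le> mdist (X i) (x i) (y i) + D"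
    and D: "0 \<le> D"
  shows "\<exists>\<sigma> :: 'g \<Rightarrow> l1 \<Rightarrow> l1. uniformly_Lipschitz_affine_action G \<sigma> \<and>
    (\<forall>s\<in>carrier G. \<sigma> s 0 = \<beta> (\<phi> s q))"
proof -
  interpret group G by fact
  interpret group_action G S \<phi> using act by (simp add: isometric_action_def)
  have iso: "product_isometry N X (\<phi> s)" if "s \<in> carrier G" for s
    using act that element_image[OF that] by unfold_locales (auto simp: isometric_action_def)
  have YS: "y \<in> S" if "y \<in> Y" for y using Y_subset that by blast
  \<comment> \<open>The translate of \<beta> by \<open>s\<close>, normalised to vanish at
    \<open>q\<close>; it is the prescribed image of \<open>\<beta> y\<close> under
    \<open>\<pi> s\<close>.\<close>
  define \<gamma> where "\<gamma> s y = \<beta> (\<phi> s y) - \<beta> (\<phi> s q)" for s y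
  define M where "M = 2 * \<Lambda> * \<rho> + 2 * \<Lambda> * N + 2 + (N * (N * (2 * (\<Lambda> * D + \<Lambda>))) + 2 * (N + 1))"
  define R where "R = to_nat_on Y ` (Y - {q})"
  have M: "1 \<le> M"
  proof -
    have "0 \<le> 2 * \<Lambda> * \<rho> + 2 * \<Lambda> * N" "0 \<le> N * (N * (2 * (\<Lambda> * D + \<Lambda>)))"
      using \<Lambda>_nonneg \<rho>_nonneg D by auto
    then show ?thesis unfolding M_def by simp
  qed
  have "norm (\<Delta> (\<gamma> s) y) \<le> M" if "s \<in> carrier G" "y \<in> Y - {q}" for s y
    unfolding \<gamma>_def M_def by (rule norm_\<Delta>_le[OF iso one]) (use that YS D in auto)
  then have "\<forall>s\<in>carrier G. \<exists>B :: l1 \<Rightarrow>\<^sub>L l1. (\<forall>y\<in>Y - {q}. blinfun_apply B (e y) = \<Delta> (\<gamma> s) y) \<and>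
    (\<forall>n. n \<notin> R \<longrightarrow> blinfun_apply B (unit_l1 n) = unit_l1 n) \<and> norm B \<le> M"
    unfolding R_def using operator_exists M by blast
  then obtain \<pi> :: "'g \<Rightarrow> l1 \<Rightarrow>\<^sub>L l1" where
    \<pi>_e: "\<And>s y. s \<in> carrier G \<Longrightarrow> y \<in> Y - {q} \<Longrightarrow> blinfun_apply (\<pi> s) (e y) = \<Delta> (\<gamma> s) y" and
    \<pi>_else: "\<And>s n. s \<in> carrier G \<Longrightarrow> n \<notin> R \<Longrightarrow> blinfun_apply (\<pi> s) (unit_l1 n) = unit_l1 n" and
    \<pi>_norm: "\<And>s. s \<in> carrier G \<Longrightarrow> norm (\<pi> s) \<le> M"
    by (metis (no_types, lifting) bchoice)
  have \<pi>_\<beta>: "blinfun_apply (\<pi> s) (\<beta> y) = \<gamma> s y" if "s \<in> carrier G" "y \<in> Y" for s y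
    using that by (intro operator_\<beta> \<pi>_e) (auto simp: \<gamma>_def)
  have comp: "\<phi> (s \<otimes> t) y = \<phi> s (\<phi> t y)" if "s \<in> carrier G" "t \<in> carrier G" "y \<in> Y" for s t y
    using composition_rule[OF YS[OF that(3)]] that by blast
  have \<pi>_\<gamma>: "blinfun_apply (\<pi> s) (\<gamma> t y) = \<gamma> (s \<otimes> t) y" if "s \<in> carrier G" "t \<in> carrier G" "y \<in> Y" for s t y
    using that q_in_Y Y_act by (simp add: \<gamma>_def[of t] blinfun.diff_right \<pi>_\<beta>) (simp add: \<gamma>_def comp)
  have R: "\<exists>y\<in>Y - {q}. unit_l1 n = e y" if "n \<in> R" for n
    using that by (auto simp: R_def e_def)
  have "\<pi> (s \<otimes> t) = \<pi> s o\<^sub>L \<pi> t" if st: "s \<in> carrier G" "t \<in> carrier G" for s t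
  proof (rule blinfun_eqI_unit_l1)
    fix n
    show "blinfun_apply (\<pi> (s \<otimes> t)) (unit_l1 n) = blinfun_apply (\<pi> s o\<^sub>L \<pi> t) (unit_l1 n)"
    proof (cases "n \<in> R")
      case True
      then obtain y where y: "y \<in> Y - {q}" "unit_l1 n = e y" using R by blast
      \<comment> \<open>The group law holds for the translates of \<beta>, and linearity of
        \<open>\<Delta>\<close> carries it over to the basis vectors.\<close>
      have "blinfun_apply (\<pi> s) (\<Delta> (\<gamma> t) y) = \<Delta> (\<lambda>x. blinfun_apply (\<pi> s) (\<gamma> t x)) y"
        by (intro \<Delta>_linear bounded_linear.linear blinfun.bounded_linear_right)
      also have "\<dots> = \<Delta> (\<gamma> (s \<otimes> t)) y" using y \<pi>_\<gamma> st by (intro \<Delta>_cong) auto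
      finally show ?thesis using st y by (simp add: \<pi>_e)
    qed (use st in \<open>simp add: \<pi>_else\<close>)
  qed
  moreover have "\<pi> \<one> = id_blinfun"
  proof (rule blinfun_eqI_unit_l1)
    fix n
    have \<phi>1: "\<phi> \<one> y = y" if "y \<in> Y" for y using id_eq_one YS[OF that] by (metis restrict_apply')
    show "blinfun_apply (\<pi> \<one>) (unit_l1 n) = blinfun_apply id_blinfun (unit_l1 n)"
    proof (cases "n \<in> R")
      case True
      then obtain y where y: "y \<in> Y - {q}" "unit_l1 n = e y" using R by blast
      have "\<Delta> (\<gamma> \<one>) y = \<Delta> \<beta> y" using y q_in_Y by (intro \<Delta>_cong) (auto simp: \<gamma>_def \<phi>1 \<beta>_base)
      then show ?thesis using y YS by (simp add: \<pi>_e \<Delta>_\<beta>)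
    qed (simp add: \<pi>_else)
  qed
  ultimately have hom: "\<pi> \<in> hom G GL" by (intro homI_GL) (auto intro: is_group)
  define b where "b s = \<beta> (\<phi> s q)" for s
  have "b (s \<otimes> t) = blinfun_apply (\<pi> s) (b t) + b s" if "s \<in> carrier G" "t \<in> carrier G" for s t
    using that q_in_Y Y_act by (simp add: b_def comp \<pi>_\<beta> \<gamma>_def)
  then have "affine_action G \<pi> b (\<lambda>s v. blinfun_apply (\<pi> s) v + b s)"
    using hom by (simp add: affine_action_def)
  moreover have "bdd_above ((\<lambda>s. norm (\<pi> s)) ` carrier G)"
    using \<pi>_norm by (intro bdd_aboveI[of _ M]) auto
  ultimately have "uniformly_Lipschitz_affine_action G (\<lambda>s v. blinfun_apply (\<pi> s) v + b s)"
    unfolding uniformly_Lipschitz_affine_action_def by blast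
  then show ?thesis by (intro exI conjI) (auto simp: b_def)
qed

end

theorem theorem1p2:
  fixes G :: "('g, 'm) monoid_scheme"
    and N :: nat
    and X :: "nat \<Rightarrow> 'a metric"
    and \<phi> :: "'g \<Rightarrow> (nat \<Rightarrow> 'a) \<Rightarrow> (nat \<Rightarrow> 'a)"
    and p :: "nat \<Rightarrow> 'a"
  assumes "group G"
    and "finitely_generated G"
    and "N \<ge> 1"
    and "\<forall>i\<in>{1..N}. quasi_tree TYPE('v) (X i)"
    and "isometric_action G (sum_product N X) \<phi>"
    and "p \<in> mspace (sum_product N X)"
  shows "\<exists>\<sigma> :: 'g \<Rightarrow> l1 \<Rightarrow> l1.
           uniformly_Lipschitz_affine_action G \<sigma> \<and>
           (\<exists>C::real. C > 0 \<and>
             (\<forall>s\<in>carrier G.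
                norm (\<sigma> s 0) \<ge> 1 / C * mdist (sum_product N X) (\<phi> s p) p - C))"
proof -
  let ?S = "\<Pi>\<^sub>E i\<in>{1..N}. mspace (X i)"
  have p: "p \<in> ?S" using assms(6) by simp
  interpret group G by fact
  interpret group_action G ?S \<phi> using assms(5) by (simp add: isometric_action_def)
  have iso: "product_isometry N X (\<phi> s)" if "s \<in> carrier G" for s
    using assms(5) that element_image[OF that] by unfold_locales (auto simp: isometric_action_def)
  have "\<forall>i\<in>{1..N}. \<exists>par A r L. coarse_tree (X i) (p i) par A r L"
    using assms(4) p by (auto intro!: quasi_tree_imp_coarse_tree)
  then obtain par A r L where trees: "\<And>i. i \<in> {1..N} \<Longrightarrow> coarse_tree (X i) (p i) (par i) (A i) (r i) (L i)"
    by metis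
  define \<rho> where "\<rho> = (\<Sum>i=1..N. r i)"
  define \<Lambda> where "\<Lambda> = (\<Sum>i=1..N. L i)"
  have r0: "0 \<le> r i" and L0: "0 \<le> L i" if "i \<in> {1..N}" for i
    using coarse_tree.r_nonneg[OF trees[OF that]] coarse_tree.L_nonneg[OF trees[OF that]] by auto
  have r_le: "r i \<le> \<rho>" and L_le: "L i \<le> \<Lambda>" if "i \<in> {1..N}" for i
    using that r0 L0 unfolding \<rho>_def \<Lambda>_def by (auto intro!: member_le_sum)
  have \<rho>: "0 \<le> \<rho>" and \<Lambda>: "0 \<le> \<Lambda>" using r0 L0 unfolding \<rho>_def \<Lambda>_def by (auto intro!: sum_nonneg)
  define K where "K j = 6 * (r j * (L j * \<rho> + L j) + \<rho>) + 2 * r j" for j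
  have K0: "0 \<le> K j" if "j \<in> {1..N}" for j
    unfolding K_def using r0[OF that] L0[OF that] \<rho> by (intro add_nonneg_nonneg mult_nonneg_nonneg) auto
  \<comment> \<open>Summing over \<open>j\<close> makes the error uniform in the coordinate as well
    as in the group element.\<close>
  define D where "D = real N * (\<Sum>j=1..N. K j)"
  have D: "0 \<le> D" unfolding D_def using K0 by (intro mult_nonneg_nonneg sum_nonneg) auto
  have one: "\<exists>i\<in>{1..N}. \<forall>x\<in>?S. \<forall>y\<in>?S. mdist (X j) (\<phi> s x j) (\<phi> s y j) \<le> mdist (X i) (x i) (y i) + D"
    if "s \<in> carrier G" "j \<in> {1..N}" for s j
    unfolding D_def
  proof (rule product_isometry.coordinate_depends_on_one[OF iso[OF that(1)] trees r_le \<rho> _ that(2)])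
    show "6 * (r j * (L j * \<rho> + L j) + \<rho>) + 2 * r j \<le> (\<Sum>j=1..N. K j)"
      using that K0 unfolding K_def[symmetric] by (intro member_le_sum) auto
  qed auto
  \<comment> \<open>The parent maps are sent to \<open>p\<close> where the coordinate is already the
    root, since \<open>par\<close> is controlled only away from it.\<close>
  define F where "F = \<phi> ` carrier G \<union> (\<lambda>i y. p(i := y i)) ` {1..N}
    \<union> (\<lambda>i y. if y i = p i then p else p(i := par i (y i))) ` {1..N}"
  obtain Y where Y: "countable Y" "p \<in> Y" "Y \<subseteq> ?S" and Y_F: "\<And>f y. f \<in> F \<Longrightarrow> y \<in> Y \<Longrightarrow> f y \<in> Y"
  proof (rule countable_closure)
    have "countable (carrier G)"
      using assms(2) countable_generate uncountable_infinite unfolding finitely_generated_def by metis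
    then show "countable F" unfolding F_def by simp
    show "p \<in> ?S" by (rule p)
    show "f y \<in> ?S" if f: "f \<in> F" and y: "y \<in> ?S" for f y
    proof -
      have upd: "p(i := x) \<in> ?S" if "i \<in> {1..N}" "x \<in> mspace (X i)" for i x
        using p that by (auto simp: PiE_iff extensional_def)
      consider s where "s \<in> carrier G" "f = \<phi> s" | i where "i \<in> {1..N}" "f = (\<lambda>y. p(i := y i))"
        | i where "i \<in> {1..N}" "f = (\<lambda>y. if y i = p i then p else p(i := par i (y i)))"
        using f unfolding F_def by blast
      then show ?thesis
      proof cases
        case 1
        then show ?thesis using element_image y by blast
      next
        case 2
        then show ?thesis using upd PiE_mem[OF y] by simp
      next
        case 3
        then show ?thesis using upd PiE_mem[OF y] p coarse_tree.par_in[OF trees] by simp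
      qed
    qed
  qed blast
  interpret T: tree_product N X p par A r L \<rho> \<Lambda> Y
  proof (rule tree_product.intro)
    show "p(i := y i) \<in> Y" if "y \<in> Y" "i \<in> {1..N}" for y i
      using Y_F[of "\<lambda>y. p(i := y i)" y] that by (auto simp: F_def)
    show "p(i := par i (y i)) \<in> Y" if "y \<in> Y" "i \<in> {1..N}" "y i \<noteq> p i" for y i
      using Y_F[of "\<lambda>y. if y i = p i then p else p(i := par i (y i))" y] that by (auto simp: F_def)
  qed (use trees r_le L_le \<rho> \<Lambda> p Y in auto)
  obtain \<sigma> :: "'g \<Rightarrow> l1 \<Rightarrow> l1" where \<sigma>: "uniformly_Lipschitz_affine_action G \<sigma>"
    "\<And>s. s \<in> carrier G \<Longrightarrow> \<sigma> s 0 = T.\<beta> (\<phi> s p)"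
  proof -
    have "\<phi> s y \<in> Y" if "s \<in> carrier G" "y \<in> Y" for s y
      using Y_F[of "\<phi> s" y] that by (auto simp: F_def)
    then show ?thesis using T.affine_action_exists[OF \<open>group G\<close> assms(5) _ one D] that by blast
  qed
  \<comment> \<open>Adding 1 to \<rho> keeps the constant positive when \<rho> is zero.\<close>
  have "1 / (\<rho> + 1) * mdist (sum_product N X) (\<phi> s p) p - (\<rho> + 1) \<le> norm (\<sigma> s 0)" if "s \<in> carrier G" for s
  proof -
    have "sum_dist N X (\<phi> s p) p \<le> \<rho> * norm (\<sigma> s 0)"
      using T.dist_le_norm_\<beta> element_image[OF that p] \<sigma>(2)[OF that] by simp
    also have "\<dots> \<le> (\<rho> + 1) * norm (\<sigma> s 0)" by (intro mult_right_mono) auto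
    finally have "1 / (\<rho> + 1) * sum_dist N X (\<phi> s p) p \<le> norm (\<sigma> s 0)"
      using \<rho> by (simp add: field_simps)
    then show ?thesis using \<rho> by simp
  qed
  then show ?thesis using \<sigma>(1) \<rho> by (intro exI[of _ \<sigma>] conjI exI[of _ "\<rho> + 1"]) auto
qed

end
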